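(* Let $D:f=0$ be a reduced surface of degree $d$ in $\mathbb{P}^3$ over $\mathbb{C}$, not a cone over a plane curve and with one-dimensional singular subscheme. (i) If $D$ is free, then $D$ is tame. (ii) Suppose $D$ is nearly free, with exponents $d_1\le d_2\le d_3=d_4$, and let $\rho_1,\rho_2,\rho_3,\rho_4$ be a minimal system of generators of $AR(f)$ of degrees $d_1,d_2,d_3,d_3$, as in the definition of a nearly free surface. Then $D$ is tame if and only if the linear forms $a_3$ and $a_4$ which occur in the second order syzygy $$a_1\rho_1+a_2\rho_2+a_3\rho_3+a_4\rho_4=0$$ are linearly independent.
   Context: Let $S=\mathbb{C}[x,y,z,w]$ with the standard grading, $f\in S$ homogeneous of degree $d$, with partial derivatives $f_x,f_y,f_z,f_w$, Jacobian ideal $J_f=(f_x,f_y,f_z,f_w)$ and Milnor algebra $M(f)=S/J_f$ (graded). The singular subscheme of $D:f=0$ is the subscheme of $\mathbb{P}^3$ defined by $J_f$. Syzygies: $AR(f)\subset S^4$ is the graded $S$-module of all $\rho=(\alpha,\beta,\gamma,\delta)$ with $\alpha f_x+\beta f_y+\gamma f_z+\delta f_w=0$; $AR(f)_q$ consists of those with all components in $S_q$, and such a $\rho$ has degree $q$. Tameness: let $\rho_1$ be a nonzero homogeneous element of minimal degree $e_1$ in $AR(f)$, and $\rho_2\in AR(f)$ a homogeneous representative of a nonzero homogeneous element of minimal degree $e_2\ge e_1$ in $AR(f)/(S\rho_1)$. Let $\Omega^k$ be the $S$-module of global algebraic differential $k$-forms on $\mathbb{C}^4$; for $\rho=(\alpha,\beta,\gamma,\delta)$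 put $\omega(\rho)=\alpha\,dx+\beta\,dy+\gamma\,dz+\delta\,dw$, and let $\Omega^1_0=\{\omega(\rho):\rho\in AR(f)\}$. $D$ is tame with respect to $\rho_1,\rho_2$ if the sequence $S(-e_1-1)\oplus S(-e_2-1)\xrightarrow{u}\Omega^1_0\xrightarrow{v}\Omega^3(e_1+e_2+2)$ is exact (at the middle term), where $u(a,b)=a\,\omega(\rho_1)+b\,\omega(\rho_2)$ and $v(\omega)=\omega(\rho_1)\wedge\omega(\rho_2)\wedge\omega$. $D$ is tame if it is tame with respect to some such pair $\rho_1,\rho_2$. Freeness: $D$ is free if $AR(f)\cong S(-d_1)\oplus S(-d_2)\oplus S(-d_3)$ as graded $S$-modules for some positive integers $d_1\le d_2\le d_3$. Near freeness: $D$ is nearly free with exponents $1\le d_1\le d_2\le d_3=d_4$ if $M(f)$ has a minimal graded free resolution of the form $$0\to S(-d-d_3)\to\bigoplus_{j=1}^{4}S(-d-d_j+1)\to S^4(-d+1)\xrightarrow{(f_x,f_y,f_z,f_w)}S.$$ Equivalently, there are four syzygies $\rho_1,\dots,\rho_4$ of degrees $d_1\le d_2\le d_3=d_4=d-(d_1+d_2)$ which form a minimal system of generators of $AR(f)$. In that case the second order syzygy module, i.e. the module of relations among $\rho_1,\dots,\rho_4$, is spanned by a unique relation $a_1\rho_1+a_2\rho_2+a_3\rho_3+a_4\rho_4=0$, with $a_1,a_2,a_3,a_4\in S$ homogeneous of degrees $d_3-d_1+1,\ d_3-d_2+1,\ 1,\ 1$.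
   Formalization: Part (ii) fails for some generators if d2 = d3 (e.g. f = x(xw+yz)); proved instead: for every choice, tame with respect to ρ1, ρ2 iff a3, a4 independent; D tame iff a3, a4 independent for some choice of generators, and for every choice if d2 < d3. *)

theory Defs
  imports
    "HOL-Analysis.Cartesian_Space"
    "HOL-Analysis.Determinants"
    "HOL-Library.Poly_Mapping"
    "HOL-Computational_Algebra.Squarefree"
begin

section \<open>The graded polynomial ring\<close>

text \<open>
  The four variables $x, y, z, w$ are indexed by $1, 2, 3, 4$ in the type \<^typ>\<open>4\<close>
  (in which \<open>4 = 0\<close>).  A monomial is a \<^typ>\<open>4 \<Rightarrow>\<^sub>0 nat\<close>, and multiplication of
  \<^typ>\<open>(4 \<Rightarrow>\<^sub>0 nat) \<Rightarrow>\<^sub>0 complex\<close> is the convolution product.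
\<close>

type_synonym S = "(4 \<Rightarrow>\<^sub>0 nat) \<Rightarrow>\<^sub>0 complex"

definition Var :: "4 \<Rightarrow> S" where
  "Var i = Poly_Mapping.single (Poly_Mapping.single i 1) 1"

definition Const :: "complex \<Rightarrow> S" where
  "Const c = Poly_Mapping.single 0 c"

definition mdeg :: "(4 \<Rightarrow>\<^sub>0 nat) \<Rightarrow> nat" where
  "mdeg m = (\<Sum>i\<in>UNIV. Poly_Mapping.lookup m i)"

text \<open>As usual, \<open>0\<close> is homogeneous of every degree.\<close>

definition homogeneous :: "nat \<Rightarrow> S \<Rightarrow> bool" where
  "homogeneous q p \<longleftrightarrow> (\<forall>m\<in>Poly_Mapping.keys p. mdeg m = q)"

definition hcomp :: "nat \<Rightarrow> S \<Rightarrow> S" where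
  "hcomp q p = (\<Sum>m\<in>{m \<in> Poly_Mapping.keys p. mdeg m = q}.
      Poly_Mapping.single m (Poly_Mapping.lookup p m))"

text \<open>If the variable \<open>i\<close> does not occur in \<open>m\<close>, the truncated subtraction is harmless
  because the coefficient vanishes.\<close>

definition partial :: "4 \<Rightarrow> S \<Rightarrow> S" where
  "partial i f = (\<Sum>m\<in>Poly_Mapping.keys f.
      Poly_Mapping.single (m - Poly_Mapping.single i 1)
        (of_nat (Poly_Mapping.lookup m i) * Poly_Mapping.lookup f m))"

text \<open>The library interprets \<^locale>\<open>module\<close> for \<open>(*s)\<close> only over fields; over a commutative
  ring the constants \<^const>\<open>module.span\<close>, \<^const>\<open>module.subspace\<close> are used with the scalar
  multiplication as explicit argument.  For \<open>scale = (*)\<close> they are the ideal generated by a set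
  and the predicate of being an ideal.\<close>

lemma module_vec: "module ((*s) :: 'a::comm_ring_1 \<Rightarrow> 'a^'n \<Rightarrow> 'a^'n)"
  by unfold_locales (simp_all add: vec_eq_iff algebra_simps)

lemma module_ring: "module ((*) :: 'a::comm_ring_1 \<Rightarrow> 'a \<Rightarrow> 'a)"
  by unfold_locales (simp_all add: algebra_simps)

definition irrelevant_ideal :: "S set" where
  "irrelevant_ideal = module.span (*) (range Var)"

definition jacobian_ideal :: "S \<Rightarrow> S set" where
  "jacobian_ideal f = module.span (*) (range (\<lambda>i. partial i f))"


section \<open>Subschemes of projective space and cones\<close>

definition prime_ideal :: "S set \<Rightarrow> bool" where
  "prime_ideal P \<longleftrightarrow> module.subspace (*) P \<and> 1 \<notin> P \<and>
     (\<forall>a b. a * b \<in> P \<longrightarrow> a \<in> P \<or> b \<in> P)"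

definition homogeneous_ideal :: "S set \<Rightarrow> bool" where
  "homogeneous_ideal I \<longleftrightarrow> module.subspace (*) I \<and> (\<forall>p\<in>I. \<forall>q. hcomp q p \<in> I)"

text \<open>The points of the subscheme \<open>Proj (S/I)\<close> of projective space.\<close>

definition Proj_points :: "S set \<Rightarrow> S set set" where
  "Proj_points I = {P. prime_ideal P \<and> homogeneous_ideal P \<and> I \<subseteq> P \<and> \<not> irrelevant_ideal \<subseteq> P}"

text \<open>Strict chains of primes correspond to strict chains of irreducible closed subsets, so
  \<open>has_proj_dim I n\<close> says that the subscheme defined by \<open>I\<close> has (Krull) dimension \<open>n\<close>.\<close>

definition proj_chain :: "S set \<Rightarrow> nat \<Rightarrow> (nat \<Rightarrow> S set) \<Rightarrow> bool" where
  "proj_chain I n P \<longleftrightarrow> (\<forall>i\<le>n. P i \<in> Proj_points I) \<and> (\<forall>i<n. P i \<subset> P (Suc i))"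

definition has_proj_dim :: "S set \<Rightarrow> nat \<Rightarrow> bool" where
  "has_proj_dim I n \<longleftrightarrow> (\<exists>P. proj_chain I n P) \<and> \<not> (\<exists>P. proj_chain I (Suc n) P)"

definition lin_subst :: "complex^4^4 \<Rightarrow> S \<Rightarrow> S" where
  "lin_subst A f = (\<Sum>m\<in>Poly_Mapping.keys f. Const (Poly_Mapping.lookup f m) *
      (\<Prod>i\<in>UNIV. (\<Sum>j\<in>UNIV. Const (A $ i $ j) * Var j) ^ Poly_Mapping.lookup m i))"

text \<open>In suitable linear coordinates the equation is that of a curve in the plane with
  coordinates $x, y, z$; the vertex is then the point $(0:0:0:1)$.\<close>

definition cone_over_plane_curve :: "S \<Rightarrow> bool" where
  "cone_over_plane_curve f \<longleftrightarrow>
     (\<exists>A :: complex^4^4. invertible A \<and>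
        (\<forall>m\<in>Poly_Mapping.keys (lin_subst A f). Poly_Mapping.lookup m 4 = 0))"


section \<open>Syzygies and differential forms\<close>

definition gradient_map :: "S \<Rightarrow> S^4 \<Rightarrow> S" where
  "gradient_map f \<rho> = (\<Sum>i\<in>UNIV. \<rho> $ i * partial i f)"

definition AR :: "S \<Rightarrow> (S^4) set" where
  "AR f = {\<rho>. gradient_map f \<rho> = 0}"

definition AR_deg :: "S \<Rightarrow> nat \<Rightarrow> (S^4) set" where
  "AR_deg f q = {\<rho> \<in> AR f. \<forall>i. homogeneous q (\<rho> $ i)}"

text \<open>
  Differential forms on affine 4-space with polynomial coefficients: the entry at \<open>I\<close> is the
  coefficient of $dx_I = dx_{i_1} \wedge \dots \wedge dx_{i_k}$, where $i_1 < \dots < i_k$ are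
  the elements of \<open>I\<close>.  The library order on \<^typ>\<open>4\<close> is \<open>4 < 1 < 2 < 3\<close>; another order would
  change the basis forms only by signs.
\<close>

type_synonym form = "S^(4 set)"

definition Omega :: "nat \<Rightarrow> form set" where
  "Omega k = {\<eta>. \<forall>I. card I \<noteq> k \<longrightarrow> \<eta> $ I = 0}"

definition wedge_sign :: "4 set \<Rightarrow> 4 set \<Rightarrow> S" where
  "wedge_sign I J = (- 1) ^ card {(i, j). i \<in> I \<and> j \<in> J \<and> j < i}"

definition wedge :: "form \<Rightarrow> form \<Rightarrow> form" (infixl \<open>\<and>\<^sub>\<Omega>\<close> 70) where
  "\<eta> \<and>\<^sub>\<Omega> \<theta> = (\<chi> K. \<Sum>I\<in>Pow K. wedge_sign I (K - I) * \<eta> $ I * \<theta> $ (K - I))"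

definition omega :: "S^4 \<Rightarrow> form" where
  "omega \<rho> = (\<chi> I. \<Sum>i\<in>UNIV. if I = {i} then \<rho> $ i else 0)"

definition Omega1_0 :: "S \<Rightarrow> form set" where
  "Omega1_0 f = omega ` AR f"


section \<open>Tame surfaces\<close>

text \<open>A homogeneous element of degree \<open>q\<close> of the quotient of \<open>AR f\<close> by \<open>S \<rho>1\<close> is the class of
  an element of \<open>AR_deg f q\<close>, and it vanishes iff this element is a multiple of \<open>\<rho>1\<close>.\<close>

definition minimal_pair :: "S \<Rightarrow> S^4 \<Rightarrow> S^4 \<Rightarrow> bool" where
  "minimal_pair f \<rho>1 \<rho>2 \<longleftrightarrow> (\<exists>e1 e2.
     \<rho>1 \<in> AR_deg f e1 \<and> \<rho>1 \<noteq> 0 \<and>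
     (\<forall>q. \<forall>\<rho>\<in>AR_deg f q. \<rho> \<noteq> 0 \<longrightarrow> e1 \<le> q) \<and>
     e1 \<le> e2 \<and>
     \<rho>2 \<in> AR_deg f e2 \<and> \<rho>2 \<notin> module.span (*s) {\<rho>1} \<and>
     (\<forall>q. \<forall>\<rho>\<in>AR_deg f q. \<rho> \<notin> module.span (*s) {\<rho>1} \<longrightarrow> e2 \<le> q))"

text \<open>The degree shifts in the defining sequence make the maps \<open>u\<close>, \<open>v\<close> homogeneous of degree \<open>0\<close>
  and do not affect exactness.\<close>

definition tame_wrt :: "S \<Rightarrow> S^4 \<Rightarrow> S^4 \<Rightarrow> bool" where
  "tame_wrt f \<rho>1 \<rho>2 \<longleftrightarrow> minimal_pair f \<rho>1 \<rho>2 \<and>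
     range (\<lambda>(a, b). a *s omega \<rho>1 + b *s omega \<rho>2) =
       {\<omega> \<in> Omega1_0 f. omega \<rho>1 \<and>\<^sub>\<Omega> omega \<rho>2 \<and>\<^sub>\<Omega> \<omega> = 0}"

definition tame :: "S \<Rightarrow> bool" where
  "tame f \<longleftrightarrow> (\<exists>\<rho>1 \<rho>2. tame_wrt f \<rho>1 \<rho>2)"


section \<open>Graded free modules, free and nearly free surfaces\<close>

text \<open>\<open>twisted_deg e q\<close> is the part of degree \<open>q\<close> of the graded free module
  $\bigoplus_i S(-e_i)$; it is \<open>0\<close> in the components with \<open>q < e $ i\<close>.\<close>

definition twisted_deg :: "nat^'n \<Rightarrow> nat \<Rightarrow> (S^'n) set" where
  "twisted_deg e q = {v. \<forall>i. \<forall>m\<in>Poly_Mapping.keys (v $ i). mdeg m + e $ i = q}"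

definition free_surface :: "S \<Rightarrow> bool" where
  "free_surface f \<longleftrightarrow> (\<exists>d1 d2 d3. 1 \<le> d1 \<and> d1 \<le> d2 \<and> d2 \<le> d3 \<and>
     (\<exists>\<phi> :: S^3 \<Rightarrow> S^4. module_hom (*s) (*s) \<phi> \<and> bij_betw \<phi> UNIV (AR f) \<and>
        (\<forall>q. \<phi> ` twisted_deg (vector [d1, d2, d3]) q = AR_deg f q)))"

definition graded_hom :: "nat^'m \<Rightarrow> nat^'n \<Rightarrow> (S^'m \<Rightarrow> S^'n) \<Rightarrow> bool" where
  "graded_hom e e' \<phi> \<longleftrightarrow> module_hom (*s) (*s) \<phi> \<and>
     (\<forall>q. \<phi> ` twisted_deg e q \<subseteq> twisted_deg e' q)"

text \<open>
  The resolution is $0 \to F_3 \to F_2 \to F_1 \to S$, with maps \<open>\<delta>3\<close>, \<open>\<delta>2\<close> and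
  \<open>gradient_map f\<close>.  The image of the last one is \<open>jacobian_ideal f\<close>, so that the cokernel is
  the Milnor algebra.  Minimality means that the image of each map lies in
  $\mathfrak{m} F_i$, $\mathfrak{m}$ the irrelevant ideal.
\<close>

definition nearly_free :: "S \<Rightarrow> nat \<Rightarrow> nat \<Rightarrow> nat \<Rightarrow> nat \<Rightarrow> bool" where
  "nearly_free f d d1 d2 d3 \<longleftrightarrow> 1 \<le> d1 \<and> d1 \<le> d2 \<and> d2 \<le> d3 \<and>
     (\<exists>(\<delta>3 :: S^1 \<Rightarrow> S^4) (\<delta>2 :: S^4 \<Rightarrow> S^4).
        graded_hom (vector [d + d3])
          (vector [d + d1 - 1, d + d2 - 1, d + d3 - 1, d + d3 - 1]) \<delta>3 \<and>
        graded_hom (vector [d + d1 - 1, d + d2 - 1, d + d3 - 1, d + d3 - 1])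
          (\<chi> i. d - 1) \<delta>2 \<and>
        inj \<delta>3 \<and> range \<delta>3 = {v. \<delta>2 v = 0} \<and> range \<delta>2 = {v. gradient_map f v = 0} \<and>
        (\<forall>v i. \<delta>3 v $ i \<in> irrelevant_ideal) \<and>
        (\<forall>v i. \<delta>2 v $ i \<in> irrelevant_ideal) \<and>
        (\<forall>v. gradient_map f v \<in> irrelevant_ideal))"

definition minimal_generators :: "S \<Rightarrow> (S^4)^4 \<Rightarrow> bool" where
  "minimal_generators f \<rho> \<longleftrightarrow>
     module.span (*s) (range (($) \<rho>)) = AR f \<and>
     (\<forall>j. module.span (*s) ((($) \<rho>) ` (UNIV - {j})) \<noteq> AR f)"

text \<open>\<open>\<rho>\<close> is a minimal system of generators of \<open>AR f\<close> of degrees \<open>d1, d2, d3, d3\<close>, and \<open>a\<close> is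
  the relation spanning the module of relations among the entries of \<open>\<rho>\<close> (it is unique up to a
  nonzero constant factor).  If \<open>d2 = d3\<close>, the entries \<open>2, 3, 4\<close> of \<open>\<rho>\<close> have the same degree and
  may be permuted, so that linear independence of \<open>a $ 3\<close> and \<open>a $ 4\<close> depends on the choice
  of \<open>\<rho>\<close>: for $f = x(xw+yz)$, with exponents $1,1,1$, the entries of \<open>a\<close> are $x, -y, z, 0$
  in an arbitrary order.\<close>

definition second_syzygy :: "S \<Rightarrow> nat \<Rightarrow> nat \<Rightarrow> nat \<Rightarrow> (S^4)^4 \<Rightarrow> S^4 \<Rightarrow> bool" where
  "second_syzygy f d1 d2 d3 \<rho> a \<longleftrightarrow>
     minimal_generators f \<rho> \<and>
     \<rho> $ 1 \<in> AR_deg f d1 \<and> \<rho> $ 2 \<in> AR_deg f d2 \<and> \<rho> $ 3 \<in> AR_deg f d3 \<and> \<rho> $ 4 \<in> AR_deg f d3 \<and>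
     homogeneous (d3 - d1 + 1) (a $ 1) \<and> homogeneous (d3 - d2 + 1) (a $ 2) \<and>
     homogeneous 1 (a $ 3) \<and> homogeneous 1 (a $ 4) \<and>
     {b :: S^4. (\<Sum>i\<in>UNIV. b $ i *s \<rho> $ i) = 0} = module.span (*s) {a}"

definition lin_indep2 :: "S \<Rightarrow> S \<Rightarrow> bool" where
  "lin_indep2 p q \<longleftrightarrow> (\<forall>c c'. Const c * p + Const c' * q = 0 \<longrightarrow> c = 0 \<and> c' = 0)"

end

theory Submission
  imports Defs
begin

text \<open>
  The form $\omega(\rho_1) \wedge \omega(\rho_2) \wedge \omega(\rho)$ has the $3 \times 3$ minors of
  $\rho_1, \rho_2, \rho$ as coefficients, so it vanishes iff the three vectors are linearly dependent
  over $S$.  Exactness of the sequence thus says that every syzygy dependent on $\rho_1, \rho_2$ lies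
  in their span.  If $D$ is free, this holds for the first two elements of a basis.

  If $D$ is nearly free, a dependence of $\rho = \sum_i c_i \rho_i$ on $\rho_1, \rho_2$ is a multiple of
  $(a_1, \dots, a_4)$, which gives $c_3 a_4 = c_4 a_3$.  When the linear forms $a_3, a_4$ are
  independent they are coprime, so $(c_3, c_4) = h (a_3, a_4)$ and subtracting $h$ times the relation
  removes $\rho_3, \rho_4$ from $\rho$.  When $\lambda a_3 + \mu a_4 = 0$, the syzygy
  $\mu \rho_3 - \lambda \rho_4$ is dependent on $\rho_1, \rho_2$ but, by minimality of the generators,
  not in their span.  Any other admissible pair extends to a minimal system of generators by graded
  exchange, with the same $a_3, a_4$ if $d_2 < d_3$.
\<close>

section \<open>Linear forms\<close>

lemma poly_mapping_sum_single: "p = (\<Sum>m\<in>Poly_Mapping.keys p. Poly_Mapping.single m (Poly_Mapping.lookup p m))"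
  by (rule poly_mapping_eqI) (simp add: lookup_sum lookup_single when_def in_keys_iff)

text \<open>A polynomial is the finite sum of its terms. The step does not ask \<open>m\<close> to
  avoid the keys of \<open>p\<close>, which suits additive statements.\<close>

lemma poly_mapping_single_induct [case_names zero add]:
  fixes p :: "'a \<Rightarrow>\<^sub>0 'b::comm_monoid_add"
  assumes "P 0" and "\<And>m c p. P p \<Longrightarrow> P (Poly_Mapping.single m c + p)"
  shows "P p"
proof -
  have "P (\<Sum>m\<in>A. Poly_Mapping.single m (Poly_Mapping.lookup p m))" if "finite A" for A
    using that by (induction A rule: finite_induct) (simp_all add: assms)
  then show ?thesis
    by (metis finite_keys poly_mapping_sum_single)
qed

text \<open>The ring endomorphism over the constants determined by the images of the variables; it
  will serve as reduction modulo a linear form.\<close>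

definition poly_subst :: "(4 \<Rightarrow> S) \<Rightarrow> S \<Rightarrow> S" where
  "poly_subst g p = (\<Sum>m\<in>Poly_Mapping.keys p. Const (Poly_Mapping.lookup p m) * (\<Prod>i\<in>UNIV. g i ^ Poly_Mapping.lookup m i))"

lemma Const_0 [simp]: "Const 0 = 0"
  and Const_1 [simp]: "Const 1 = 1"
  and Const_add: "Const (a + b) = Const a + Const b"
  and Const_mult: "Const (a * b) = Const a * Const b"
  and Const_minus: "Const (- a) = - Const a"
  and Const_eq_0_iff [simp]: "Const a = 0 \<longleftrightarrow> a = 0"
  by (simp_all add: Const_def single_add mult_single single_uminus)
     (metis lookup_single_eq lookup_zero single_zero)

lemma Const_mult_single: "Const c * Poly_Mapping.single m b = Poly_Mapping.single m (c * b)"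
  by (simp add: Const_def mult_single)

lemma poly_subst_0 [simp]: "poly_subst g 0 = 0"
  by (simp add: poly_subst_def)

lemma poly_subst_add: "poly_subst g (p + q) = poly_subst g p + poly_subst g q"
  unfolding poly_subst_def
  by (rule setsum_keys_plus_distrib) (simp_all add: Const_add algebra_simps)

lemma poly_subst_single:
  "poly_subst g (Poly_Mapping.single m c) = Const c * (\<Prod>i\<in>UNIV. g i ^ Poly_Mapping.lookup m i)"
  by (cases "c = 0") (simp_all add: poly_subst_def)

text \<open>Additivity in both factors reduces the claim to two single terms, whose exponents add
  and whose coefficients multiply.\<close>

lemma poly_subst_mult: "poly_subst g (p * q) = poly_subst g p * poly_subst g q"
proof (induction p rule: poly_mapping_single_induct)
  case (add m c p)
  have "poly_subst g (Poly_Mapping.single m c * q) = poly_subst g (Poly_Mapping.single m c) * poly_subst g q"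
  proof (induction q rule: poly_mapping_single_induct)
    case (add n b q)
    then show ?case
      by (simp add: distrib_left poly_subst_add mult_single poly_subst_single Const_mult
          lookup_add power_add prod.distrib mult_ac)
  qed simp
  with add show ?case
    by (simp add: distrib_right poly_subst_add)
qed simp

lemma poly_subst_sum: "poly_subst g (sum h A) = (\<Sum>i\<in>A. poly_subst g (h i))"
  by (induction A rule: infinite_finite_induct) (simp_all add: poly_subst_add)

lemma poly_subst_Const [simp]: "poly_subst g (Const c) = Const c"
  by (simp add: Const_def[of c] poly_subst_single)

lemma poly_subst_Var [simp]: "poly_subst g (Var i) = g i"
proof -
  have "(\<Prod>j\<in>UNIV. g j ^ Poly_Mapping.lookup (Poly_Mapping.single i 1) j) = (\<Prod>j\<in>UNIV. if j = i then g i else 1)"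
    by (rule prod.cong) (auto simp: lookup_single when_def)
  then show ?thesis
    by (simp add: Var_def poly_subst_single)
qed

text \<open>Gives a term the shape that \<open>poly_subst\<close> produces, so that a term and its
  image can be compared factor by factor.\<close>

lemma single_eq_prod_Var: "Poly_Mapping.single m c = Const c * (\<Prod>i\<in>UNIV. Var i ^ Poly_Mapping.lookup m i)"
proof -
  have pow: "Var i ^ n = Poly_Mapping.single (Poly_Mapping.single i n) 1" for i n
    by (induction n) (simp_all add: Var_def mult_single single_add [symmetric] flip: single_one)
  have prd: "(\<Prod>i\<in>A. Poly_Mapping.single (h i) (1::complex)) = Poly_Mapping.single (\<Sum>i\<in>A. h i) 1"
    for A :: "4 set" and h :: "4 \<Rightarrow> 4 \<Rightarrow>\<^sub>0 nat"
    by (induction A rule: infinite_finite_induct) (simp_all add: mult_single)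
  have "(\<Sum>i\<in>UNIV. Poly_Mapping.single i (Poly_Mapping.lookup m i)) = m"
    by (rule poly_mapping_eqI) (simp add: lookup_sum lookup_single when_def)
  then show ?thesis
    by (simp add: pow prd Const_mult_single)
qed

section \<open>Congruences modulo one element\<close>

lemma dvd_power_diff:
  fixes a b p :: "'a::comm_ring_1"
  assumes "p dvd a - b"
  shows "p dvd a ^ n - b ^ n"
proof (induction n)
  case (Suc n)
  have "a ^ Suc n - b ^ Suc n = (a - b) * a ^ n + b * (a ^ n - b ^ n)"
    by (simp add: algebra_simps)
  with Suc assms show ?case
    by (simp add: dvd_add dvd_mult dvd_mult2)
qed simp

lemma dvd_prod_diff:
  fixes p :: "'a::comm_ring_1"
  assumes "\<And>i. p dvd g i - h i"
  shows "p dvd prod g A - prod h A"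
proof (induction A rule: infinite_finite_induct)
  case (insert x A)
  have "prod g (insert x A) - prod h (insert x A)
      = (g x - h x) * prod g A + h x * (prod g A - prod h A)"
    using insert by (simp add: algebra_simps)
  with insert assms show ?case
    by (simp add: dvd_add dvd_mult dvd_mult2)
qed simp_all

text \<open>Congruence modulo \<open>p\<close> passes from the variables to powers, products and
  sums.\<close>

lemma dvd_poly_subst_diff:
  assumes "\<And>i. p dvd g i - Var i"
  shows "p dvd poly_subst g r - r"
proof (induction r rule: poly_mapping_single_induct)
  case (add m c r)
  have "poly_subst g (Poly_Mapping.single m c) - Poly_Mapping.single m c
      = Const c * ((\<Prod>i\<in>UNIV. g i ^ Poly_Mapping.lookup m i) - (\<Prod>i\<in>UNIV. Var i ^ Poly_Mapping.lookup m i))"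
    by (subst (2) single_eq_prod_Var) (simp add: poly_subst_single algebra_simps)
  moreover have "p dvd (\<Prod>i\<in>UNIV. g i ^ Poly_Mapping.lookup m i) - (\<Prod>i\<in>UNIV. Var i ^ Poly_Mapping.lookup m i)"
    by (intro dvd_prod_diff dvd_power_diff assms)
  ultimately have "p dvd poly_subst g (Poly_Mapping.single m c) - Poly_Mapping.single m c"
    by (simp add: dvd_mult)
  then have "p dvd (poly_subst g (Poly_Mapping.single m c) - Poly_Mapping.single m c) + (poly_subst g r - r)"
    using add by (rule dvd_add)
  then show ?case
    by (simp add: poly_subst_add algebra_simps)
qed simp

section \<open>Degrees of monomials and linear forms\<close>

lemma mdeg_0 [simp]: "mdeg 0 = 0"
  and mdeg_add: "mdeg (m + n) = mdeg m + mdeg n"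
  by (simp_all add: mdeg_def lookup_add sum.distrib)

lemma mdeg_eq_0_iff: "mdeg m = 0 \<longleftrightarrow> m = 0"
  by (auto simp: mdeg_def intro: poly_mapping_eqI)

lemma mdeg_eq_1D:
  assumes "mdeg m = 1"
  obtains i where "m = Poly_Mapping.single i 1"
proof -
  obtain i where i: "Poly_Mapping.lookup m i = 1" "\<And>j. j \<noteq> i \<Longrightarrow> Poly_Mapping.lookup m j = 0"
    using assms by (auto simp: mdeg_def sum_eq_Suc0_iff)
  have "m = Poly_Mapping.single i 1"
    by (rule poly_mapping_eqI) (auto simp: lookup_single when_def i)
  then show thesis
    by (rule that)
qed

lemma linear_form_eq_sum:
  assumes "homogeneous 1 p"
  shows "p = (\<Sum>i\<in>UNIV. Const (Poly_Mapping.lookup p (Poly_Mapping.single i 1)) * Var i)"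
proof (rule poly_mapping_eqI)
  fix m
  have rhs: "Poly_Mapping.lookup (\<Sum>i\<in>UNIV. Const (Poly_Mapping.lookup p (Poly_Mapping.single i 1)) * Var i) m
      = (\<Sum>i\<in>UNIV. Poly_Mapping.lookup p (Poly_Mapping.single i 1) when Poly_Mapping.single i 1 = m)"
    by (simp add: lookup_sum Var_def Const_mult_single lookup_single)
  show "Poly_Mapping.lookup p m = Poly_Mapping.lookup (\<Sum>i\<in>UNIV. Const (Poly_Mapping.lookup p (Poly_Mapping.single i 1)) * Var i) m"
  proof (cases "mdeg m = 1")
    case True
    then obtain j where m: "m = Poly_Mapping.single j 1"
      by (rule mdeg_eq_1D)
    have "Poly_Mapping.single i (1::nat) = Poly_Mapping.single j 1 \<longleftrightarrow> i = j" for i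
      by (metis lookup_single_eq lookup_single_not_eq zero_neq_one)
    then show ?thesis
      unfolding rhs by (simp add: m when_def)
  next
    case False
    then have "Poly_Mapping.single i 1 \<noteq> m" for i
      by (auto simp: mdeg_def lookup_single when_def)
    with False assms show ?thesis
      unfolding rhs by (auto simp: homogeneous_def in_keys_iff)
  qed
qed

text \<open>Reducing modulo \<open>p\<close> is realised by a substitution that kills \<open>p\<close> but not \<open>q\<close>.\<close>

lemma linear_forms_coprime:
  assumes "homogeneous 1 p" "homogeneous 1 q" and ind: "lin_indep2 p q"
    and eq: "r * q = s * p"
  obtains h where "r = h * p" "s = h * q"
proof -
  define \<alpha> where "\<alpha> i = Poly_Mapping.lookup p (Poly_Mapping.single i 1)" for i
  define \<beta> where "\<beta> i = Poly_Mapping.lookup q (Poly_Mapping.single i 1)" for i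
  have p: "p = (\<Sum>i\<in>UNIV. Const (\<alpha> i) * Var i)" and q: "q = (\<Sum>i\<in>UNIV. Const (\<beta> i) * Var i)"
    unfolding \<alpha>_def \<beta>_def by (intro linear_form_eq_sum assms)+
  have "p \<noteq> 0"
    using ind unfolding lin_indep2_def by (metis Const_0 Const_1 add_0 mult_zero_left mult_zero_right zero_neq_one)
  then obtain k where k: "\<alpha> k \<noteq> 0"
    using p by (metis (no_types, lifting) Const_0 mult_zero_left sum.neutral)
  \<comment> \<open>Solves \<open>p = 0\<close> for a variable \<open>k\<close> that occurs in
    \<open>p\<close>: subtracting \<open>p\<close> over its coefficient there sends \<open>p\<close>
    to 0 and moves every variable by a multiple of \<open>p\<close>.\<close>
  define g where "g i = Var i - (if i = k then Const (1 / \<alpha> k) * p else 0)" for i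
  have lin: "poly_subst g (\<Sum>i\<in>UNIV. Const (\<gamma> i) * Var i)
      = (\<Sum>i\<in>UNIV. Const (\<gamma> i) * Var i) - Const (\<gamma> k / \<alpha> k) * p" for \<gamma>
  proof -
    have "poly_subst g (\<Sum>i\<in>UNIV. Const (\<gamma> i) * Var i)
        = (\<Sum>i\<in>UNIV. Const (\<gamma> i) * Var i - (if i = k then Const (\<gamma> i) * Const (1 / \<alpha> k) * p else 0))"
      unfolding poly_subst_sum by (rule sum.cong) (simp_all add: poly_subst_mult g_def algebra_simps)
    then show ?thesis
      by (simp add: sum_subtractf flip: Const_mult)
  qed
  have "poly_subst g p = 0"
    using lin[of \<alpha>] k by (simp flip: p)
  \<comment> \<open>The image of \<open>q\<close> is a combination of \<open>q\<close> and
    \<open>p\<close> with coefficient 1 at \<open>q\<close>, hence nonzero by independence; it can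
    then be cancelled in the image of \<open>r * q = s * p\<close>.\<close>
  moreover have "poly_subst g q = Const 1 * q + Const (- (\<beta> k / \<alpha> k)) * p"
    using lin[of \<beta>] by (simp add: Const_minus flip: q)
  then have "poly_subst g q \<noteq> 0"
    using ind unfolding lin_indep2_def by (metis add.commute zero_neq_one)
  moreover have "poly_subst g r * poly_subst g q = poly_subst g s * poly_subst g p"
    by (metis eq poly_subst_mult)
  ultimately have "poly_subst g r = 0"
    by simp
  \<comment> \<open>\<open>r\<close> is congruent modulo \<open>p\<close> to its image, which is
    0.\<close>
  moreover have "p dvd poly_subst g r - r"
    by (rule dvd_poly_subst_diff) (simp add: g_def)
  ultimately obtain h where h: "r = h * p"
    by (metis diff_0 dvd_def dvd_minus_iff mult.commute)
  then have "s * p = (h * q) * p"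
    using eq by algebra
  with \<open>p \<noteq> 0\<close> have "s = h * q"
    using mult_right_cancel by blast
  with h show thesis
    by (rule that)
qed

section \<open>Linear dependence of three syzygies\<close>

text \<open>Fraction-free Gaussian elimination, by induction on the coordinates: each one either
  vanishes on all vectors or supplies a pivot, which costs one vector.\<close>

lemma exists_linear_relation:
  fixes v :: "'i \<Rightarrow> 'j \<Rightarrow> 'a::idom"
  assumes "finite J" and "finite I" and "card J < card I"
  shows "\<exists>c. (\<exists>i\<in>I. c i \<noteq> 0) \<and> (\<forall>j\<in>J. (\<Sum>i\<in>I. c i * v i j) = 0)"
  using assms
proof (induction J arbitrary: I v rule: finite_induct)
  case empty
  then have "I \<noteq> {}"
    by auto
  then show ?case
    by (intro exI[of _ "\<lambda>_. 1"]) auto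
next
  case (insert j J)
  show ?case
  proof (cases "\<forall>i\<in>I. v i j = 0")
    case True
    obtain c where "\<exists>i\<in>I. c i \<noteq> 0" "\<forall>j\<in>J. (\<Sum>i\<in>I. c i * v i j) = 0"
      using insert.IH[of I v] insert.hyps insert.prems by auto
    then show ?thesis
      using True by (intro exI[of _ c]) simp
  next
    case False
    then obtain k where k: "k \<in> I" "v k j \<noteq> 0"
      by blast
    \<comment> \<open>Multiplying by the pivot instead of dividing by it keeps the elimination
      inside the domain. Coordinate \<open>j\<close> of every \<open>w i\<close> is 0, so the
      equation at \<open>j\<close> comes for free.\<close>
    define w where "w i l = v k j * v i l - v i j * v k l" for i l
    have "card J < card (I - {k})"
      using k insert.hyps insert.prems by simp
    then obtain c where c: "\<exists>i\<in>I - {k}. c i \<noteq> 0" "\<forall>l\<in>J. (\<Sum>i\<in>I - {k}. c i * w i l) = 0"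
      using insert.IH[of "I - {k}" w] insert.prems by auto
    \<comment> \<open>The relation among the \<open>w i\<close>, rewritten for the
      \<open>v i\<close>: the coefficient at \<open>k\<close> collects the subtracted multiples of
      the pivot vector.\<close>
    define c' where "c' i = (if i = k then - (\<Sum>i\<in>I - {k}. c i * v i j) else v k j * c i)" for i
    have "(\<Sum>i\<in>I. c' i * v i l) = (\<Sum>i\<in>I - {k}. c i * w i l)" for l
    proof -
      have "(\<Sum>i\<in>I - {k}. c' i * v i l) = (\<Sum>i\<in>I - {k}. v k j * c i * v i l)"
        by (rule sum.cong) (auto simp: c'_def)
      moreover have "(\<Sum>i\<in>I. c' i * v i l) = c' k * v k l + (\<Sum>i\<in>I - {k}. c' i * v i l)"
        using k insert.prems by (simp add: sum.remove)
      moreover have "c' k * v k l = (\<Sum>i\<in>I - {k}. - (c i * v i j * v k l))"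
        by (simp add: c'_def sum_distrib_right sum_negf)
      ultimately show ?thesis
        by (simp add: w_def algebra_simps flip: sum.distrib)
    qed
    moreover have "\<exists>i\<in>I. c' i \<noteq> 0"
      using c(1) k by (auto simp: c'_def)
    ultimately show ?thesis
      using c(2) by (intro exI[of _ c']) (simp add: w_def)
  qed
qed

text \<open>Coefficients are taken in the domain itself; clearing denominators shows that this is
  dependence over the fraction field.\<close>

definition lin_dep3 :: "'a::idom^'n \<Rightarrow> 'a^'n \<Rightarrow> 'a^'n \<Rightarrow> bool" where
  "lin_dep3 u v w \<longleftrightarrow>
     (\<exists>a b c. (a \<noteq> 0 \<or> b \<noteq> 0 \<or> c \<noteq> 0) \<and> a *s u + b *s v + c *s w = 0)"

lemma lin_dep3I:
  assumes "\<And>i. a * u $ i + b * v $ i + c * w $ i = 0" and "a \<noteq> 0 \<or> b \<noteq> 0 \<or> c \<noteq> 0"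
  shows "lin_dep3 u v w"
  unfolding lin_dep3_def using assms
  by (intro exI[of _ a] exI[of _ b] exI[of _ c]) (simp add: vec_eq_iff)

text \<open>The determinant of the columns \<open>i\<close>, \<open>j\<close>, \<open>k\<close> of
  the matrix with rows \<open>u\<close>, \<open>v\<close>, \<open>w\<close>, expanded along the
  first row. The indices may come in any order and may repeat.\<close>

definition minor3 :: "'a::idom^'n \<Rightarrow> 'a^'n \<Rightarrow> 'a^'n \<Rightarrow> 'n \<Rightarrow> 'n \<Rightarrow> 'n \<Rightarrow> 'a" where
  "minor3 u v w i j k = u $ i * (v $ j * w $ k - v $ k * w $ j)
     - u $ j * (v $ i * w $ k - v $ k * w $ i) + u $ k * (v $ i * w $ j - v $ j * w $ i)"

text \<open>From left to right this is Cramer's rule: each coefficient times a minor is a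
  combination of coordinates of the relation. Conversely, a nonzero 2x2 minor of \<open>u\<close>
  and \<open>v\<close> yields a relation with \<open>w\<close>; without one, \<open>u\<close> and
  \<open>v\<close> are already dependent.\<close>

lemma lin_dep3_iff_minor3: "lin_dep3 u v w \<longleftrightarrow> (\<forall>i j k. minor3 u v w i j k = 0)"
proof
  assume "lin_dep3 u v w"
  then obtain a b c where nz: "a \<noteq> 0 \<or> b \<noteq> 0 \<or> c \<noteq> 0" and "a *s u + b *s v + c *s w = 0"
    unfolding lin_dep3_def by blast
  then have rel: "a * u $ i + b * v $ i + c * w $ i = 0" for i
    by (simp add: vec_eq_iff)
  have "a * minor3 u v w i j k = 0" "b * minor3 u v w i j k = 0" "c * minor3 u v w i j k = 0"
    for i j k
  proof -
    let ?r = "\<lambda>l. a * u $ l + b * v $ l + c * w $ l"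
    have "a * minor3 u v w i j k = ?r i * (v $ j * w $ k - v $ k * w $ j)
        - ?r j * (v $ i * w $ k - v $ k * w $ i) + ?r k * (v $ i * w $ j - v $ j * w $ i)"
      by (simp add: minor3_def algebra_simps)
    then show "a * minor3 u v w i j k = 0"
      by (simp add: rel)
    have "b * minor3 u v w i j k = - ?r i * (u $ j * w $ k - u $ k * w $ j)
        + ?r j * (u $ i * w $ k - u $ k * w $ i) - ?r k * (u $ i * w $ j - u $ j * w $ i)"
      by (simp add: minor3_def algebra_simps)
    then show "b * minor3 u v w i j k = 0"
      by (simp add: rel)
    have "c * minor3 u v w i j k = ?r i * (u $ j * v $ k - u $ k * v $ j)
        - ?r j * (u $ i * v $ k - u $ k * v $ i) + ?r k * (u $ i * v $ j - u $ j * v $ i)"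
      by (simp add: minor3_def algebra_simps)
    then show "c * minor3 u v w i j k = 0"
      by (simp add: rel)
  qed
  with nz show "\<forall>i j k. minor3 u v w i j k = 0"
    by auto
next
  assume minors: "\<forall>i j k. minor3 u v w i j k = 0"
  show "lin_dep3 u v w"
  proof (cases "\<exists>i j. u $ i * v $ j - u $ j * v $ i \<noteq> 0")
    case True
    then obtain i j where ij: "u $ i * v $ j - u $ j * v $ i \<noteq> 0"
      by blast
    show ?thesis
    proof (rule lin_dep3I)
      \<comment> \<open>The coefficients are the cofactors in the expansion of the minor along
        column \<open>k\<close>. They do not depend on \<open>k\<close>, and the last one is
        nonzero.\<close>
      show "(v $ i * w $ j - v $ j * w $ i) * u $ k + (u $ j * w $ i - u $ i * w $ j) * v $ k
          + (u $ i * v $ j - u $ j * v $ i) * w $ k = 0" for k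
        using minors[rule_format, of i j k] by (simp add: minor3_def algebra_simps)
    qed (use ij in blast)
  next
    case no_minor: False
    show ?thesis
    proof (cases "u = 0")
      case True
      then show ?thesis
        by (intro lin_dep3I[where a = 1 and b = 0 and c = 0]) auto
    next
      case False
      then obtain i where i: "u $ i \<noteq> 0"
        by (auto simp: vec_eq_iff)
      show ?thesis
      proof (rule lin_dep3I)
        show "v $ i * u $ k + (- u $ i) * v $ k + 0 * w $ k = 0" for k
          using no_minor by (simp add: mult.commute)
      qed (use i in auto)
    qed
  qed
qed

section \<open>Coordinates of wedge products of one-forms\<close>

lemma wedge_sign_singleton: "wedge_sign I {k} = (- 1) ^ card {i \<in> I. k < i}"
proof -
  have "{(i, j). i \<in> I \<and> j \<in> {k} \<and> j < i} = (\<lambda>i. (i, k)) ` {i \<in> I. k < i}"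
    by auto
  then show ?thesis
    by (simp add: wedge_sign_def card_image inj_on_def)
qed

lemma omega_nth: "omega \<rho> $ I = (if card I = 1 then \<rho> $ the_elem I else 0)"
proof (cases "card I = 1")
  case True
  then obtain i where "I = {i}"
    by (auto simp: card_1_singleton_iff)
  then show ?thesis
    by (simp add: omega_def)
next
  case False
  then show ?thesis
    by (auto simp: omega_def intro!: sum.neutral)
qed

text \<open>A one-form has coefficients only at singletons, so only the splittings of
  \<open>K\<close> with a single index in the second factor survive.\<close>

lemma wedge_omega_nth:
  "(\<eta> \<and>\<^sub>\<Omega> omega \<rho>) $ K = (\<Sum>k\<in>K. wedge_sign (K - {k}) {k} * \<eta> $ (K - {k}) * \<rho> $ k)"
proof -
  have inj: "inj_on (\<lambda>k. K - {k}) K"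
    by (auto simp: inj_on_def)
  have "(\<eta> \<and>\<^sub>\<Omega> omega \<rho>) $ K
      = (\<Sum>I\<in>(\<lambda>k. K - {k}) ` K. wedge_sign I (K - I) * \<eta> $ I * omega \<rho> $ (K - I))"
    unfolding wedge_def
  proof (simp, rule sum.mono_neutral_right)
    show "\<forall>I\<in>Pow K - (\<lambda>k. K - {k}) ` K. wedge_sign I (K - I) * \<eta> $ I * omega \<rho> $ (K - I) = 0"
    proof
      fix I assume I: "I \<in> Pow K - (\<lambda>k. K - {k}) ` K"
      have "card (K - I) \<noteq> 1"
      proof
        assume "card (K - I) = 1"
        then obtain k where "K - I = {k}"
          by (auto simp: card_1_singleton_iff)
        with I have "k \<in> K" "I = K - {k}"
          by auto
        with I show False
          by blast
      qed
      then show "wedge_sign I (K - I) * \<eta> $ I * omega \<rho> $ (K - I) = 0"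
        by (simp add: omega_nth)
    qed
  qed auto
  also have "\<dots> = (\<Sum>k\<in>K. wedge_sign (K - {k}) {k} * \<eta> $ (K - {k}) * \<rho> $ k)"
    unfolding sum.reindex[OF inj]
  proof (rule sum.cong)
    fix k assume "k \<in> K"
    then have "K - (K - {k}) = {k}"
      by auto
    then show "((\<lambda>I. wedge_sign I (K - I) * \<eta> $ I * omega \<rho> $ (K - I)) \<circ> (\<lambda>k. K - {k})) k
        = wedge_sign (K - {k}) {k} * \<eta> $ (K - {k}) * \<rho> $ k"
      by (simp add: omega_nth)
  qed simp
  finally show ?thesis .
qed

lemma wedge2_nth:
  assumes "i < j"
  shows "(omega u \<and>\<^sub>\<Omega> omega v) $ {i, j} = u $ i * v $ j - u $ j * v $ i"
proof -
  have diff: "{i, j} - {i} = {j}" "{i, j} - {j} = {i}"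
    using assms by auto
  have "{x \<in> {i}. j < x} = {}" "{x \<in> {j}. i < x} = {j}"
    using assms by auto
  then have "wedge_sign {i} {j} = 1" "wedge_sign {j} {i} = - 1"
    by (simp_all only: wedge_sign_singleton) simp_all
  moreover have "(omega u \<and>\<^sub>\<Omega> omega v) $ {i, j}
      = wedge_sign {j} {i} * u $ j * v $ i + wedge_sign {i} {j} * u $ i * v $ j"
    using assms by (simp add: wedge_omega_nth diff omega_nth del: insert_Diff_single Diff_insert0)
  ultimately show ?thesis
    by simp
qed

text \<open>Laplace expansion along the row \<open>w\<close>: moving its index past the larger ones
  produces the signs plus, minus, plus.\<close>

lemma wedge3_nth:
  assumes "i < j" "j < k"
  shows "(omega u \<and>\<^sub>\<Omega> omega v \<and>\<^sub>\<Omega> omega w) $ {i, j, k} = minor3 u v w i j k"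
proof -
  have less: "i < j" "j < k" "i < k" "i \<noteq> j" "j \<noteq> k" "i \<noteq> k"
    using assms by auto
  have diff: "{i, j, k} - {i} = {j, k}" "{i, j, k} - {j} = {i, k}" "{i, j, k} - {k} = {i, j}"
    using less by auto
  have "{x \<in> {j, k}. i < x} = {j, k}" "{x \<in> {i, k}. j < x} = {k}" "{x \<in> {i, j}. k < x} = {}"
    using assms by auto
  then have sgn: "wedge_sign {j, k} {i} = 1" "wedge_sign {i, k} {j} = - 1"
    "wedge_sign {i, j} {k} = 1"
    using less by (simp_all only: wedge_sign_singleton) simp_all
  have "(\<Sum>l\<in>{i, j, k}. h l) = h i + h j + h k" for h :: "4 \<Rightarrow> S"
    using less by (simp add: add.assoc)
  then show ?thesis
    by (simp only: wedge_omega_nth[of "omega u \<and>\<^sub>\<Omega> omega v"] diff sgn wedge2_nth less)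
      (simp add: minor3_def algebra_simps)
qed

lemma wedge3_nth_eq_0:
  assumes "card K \<noteq> 3"
  shows "(omega u \<and>\<^sub>\<Omega> omega v \<and>\<^sub>\<Omega> omega w) $ K = 0"
proof -
  have "card (K - {k} - {j}) \<noteq> 1" if "k \<in> K" "j \<in> K - {k}" for j k
    using assms that by (simp add: card_Diff_singleton)
  then show ?thesis
    by (simp add: wedge_omega_nth omega_nth)
qed

text \<open>The coefficients of the form are the minors with increasing indices. These determine all
  minors, because a minor is alternating in its columns.\<close>

lemma wedge3_eq_0_iff: "omega u \<and>\<^sub>\<Omega> omega v \<and>\<^sub>\<Omega> omega w = 0 \<longleftrightarrow> lin_dep3 u v w"
proof
  assume "lin_dep3 u v w"
  then have minors: "minor3 u v w i j k = 0" for i j k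
    by (simp add: lin_dep3_iff_minor3)
  have "(omega u \<and>\<^sub>\<Omega> omega v \<and>\<^sub>\<Omega> omega w) $ K = 0" for K
  proof (cases "card K = 3")
    case True
    define xs where "xs = sorted_list_of_set K"
    have "length xs = 3" "set xs = K" "sorted_wrt (<) xs"
      using True by (simp_all add: xs_def)
    then obtain i j k where "K = {i, j, k}" "i < j" "j < k"
      by (auto simp: numeral_3_eq_3 length_Suc_conv)
    then show ?thesis
      by (simp add: wedge3_nth minors)
  qed (rule wedge3_nth_eq_0)
  then show "omega u \<and>\<^sub>\<Omega> omega v \<and>\<^sub>\<Omega> omega w = 0"
    by (simp add: vec_eq_iff)
next
  assume "omega u \<and>\<^sub>\<Omega> omega v \<and>\<^sub>\<Omega> omega w = 0"
  then have sorted: "minor3 u v w i j k = 0" if "i < j" "j < k" for i j k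
    using wedge3_nth[OF that, of u v w] by simp
  have swap: "minor3 u v w j i k = - minor3 u v w i j k" "minor3 u v w i k j = - minor3 u v w i j k"
    and diag: "minor3 u v w i i k = 0" "minor3 u v w i k i = 0" "minor3 u v w k i i = 0" for i j k
    by (simp_all add: minor3_def algebra_simps)
  \<comment> \<open>The case where the last index is the largest comes first; column swaps reduce
    the other arrangements of distinct indices to it.\<close>
  have max: "minor3 u v w i j k = 0" if "i < k" "j < k" for i j k
    using that sorted[of i j k] sorted[of j i k] swap(1)[of i j k] diag(1)
    by (cases i j rule: linorder_cases) auto
  have "minor3 u v w i j k = 0" for i j k
  proof -
    consider "i < k" "j < k" | "i < j" "k < j" | "j < i" "k < i" | "i = j \<or> j = k \<or> i = k"
      by (cases i j rule: linorder_cases; cases j k rule: linorder_cases;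
          cases i k rule: linorder_cases) auto
    then show ?thesis
    proof cases
      case 1
      then show ?thesis
        by (rule max)
    next
      case 2
      then show ?thesis
        using max swap(2) by (metis neg_equal_0_iff_equal)
    next
      case 3
      then show ?thesis
        using max swap by (metis neg_equal_0_iff_equal)
    next
      case 4
      then show ?thesis
        using diag by blast
    qed
  qed
  then show "lin_dep3 u v w"
    by (simp add: lin_dep3_iff_minor3)
qed

section \<open>From the sequence of forms to syzygies\<close>

lemma omega_comb: "omega (a *s u + b *s v) = a *s omega u + b *s omega v"
  by (simp add: vec_eq_iff omega_nth)

lemma omega_inject: "omega u = omega v \<longleftrightarrow> u = v"
proof
  assume "omega u = omega v"
  then have "omega u $ {i} = omega v $ {i}" for i
    by simp
  then show "u = v"
    by (simp add: omega_nth vec_eq_iff)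
qed simp

lemma gradient_map_add: "gradient_map f (u + v) = gradient_map f u + gradient_map f v"
  by (simp add: gradient_map_def distrib_right sum.distrib)

lemma gradient_map_scale: "gradient_map f (c *s u) = c * gradient_map f u"
  by (simp add: gradient_map_def mult.assoc sum_distrib_left)

lemma AR_add: "u \<in> AR f \<Longrightarrow> v \<in> AR f \<Longrightarrow> u + v \<in> AR f"
  and AR_scale: "u \<in> AR f \<Longrightarrow> c *s u \<in> AR f"
  unfolding AR_def by (simp_all add: gradient_map_add gradient_map_scale)

text \<open>Since \<open>omega\<close> is linear and injective, image and kernel can be compared as
  sets of syzygies. The image always lies in the kernel, so exactness is the reverse
  inclusion.\<close>

lemma tame_sequence_exact_iff:
  assumes "\<rho>1 \<in> AR f" "\<rho>2 \<in> AR f"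
  shows "range (\<lambda>(a, b). a *s omega \<rho>1 + b *s omega \<rho>2) =
       {\<omega> \<in> Omega1_0 f. omega \<rho>1 \<and>\<^sub>\<Omega> omega \<rho>2 \<and>\<^sub>\<Omega> \<omega> = 0} \<longleftrightarrow>
     (\<forall>\<rho>\<in>AR f. lin_dep3 \<rho>1 \<rho>2 \<rho> \<longrightarrow> (\<exists>a b. \<rho> = a *s \<rho>1 + b *s \<rho>2))"
proof -
  have u: "range (\<lambda>(a, b). a *s omega \<rho>1 + b *s omega \<rho>2) = omega ` {a *s \<rho>1 + b *s \<rho>2 | a b. True}"
    by (auto simp flip: omega_comb)
  have v: "{\<omega> \<in> Omega1_0 f. omega \<rho>1 \<and>\<^sub>\<Omega> omega \<rho>2 \<and>\<^sub>\<Omega> \<omega> = 0}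
      = omega ` {\<rho> \<in> AR f. lin_dep3 \<rho>1 \<rho>2 \<rho>}"
    by (auto simp: Omega1_0_def wedge3_eq_0_iff)
  have inj: "inj omega"
    by (simp add: inj_def omega_inject)
  have "lin_dep3 \<rho>1 \<rho>2 (a *s \<rho>1 + b *s \<rho>2)" for a b
    by (rule lin_dep3I[where a = a and b = b and c = "- 1"]) auto
  then have "{a *s \<rho>1 + b *s \<rho>2 | a b. True} \<subseteq> {\<rho> \<in> AR f. lin_dep3 \<rho>1 \<rho>2 \<rho>}"
    using assms by (auto intro: AR_add AR_scale)
  then show ?thesis
    unfolding u v inj_image_eq_iff[OF inj] by blast
qed

section \<open>Graded linear combinations\<close>

text \<open>The map from the free module on the entries of \<rho>: its range is their span, its
  kernel the module of relations among them.\<close>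

definition lincomb :: "('a::comm_ring_1^'n)^'m \<Rightarrow> 'a^'m \<Rightarrow> 'a^'n" where
  "lincomb \<rho> b = (\<Sum>i\<in>UNIV. b $ i *s \<rho> $ i)"

lemma lincomb_nth: "lincomb \<rho> b $ j = (\<Sum>i\<in>UNIV. b $ i * \<rho> $ i $ j)"
  by (simp add: lincomb_def)

lemma lincomb_0 [simp]: "lincomb \<rho> 0 = 0"
  and lincomb_add: "lincomb \<rho> (b + c) = lincomb \<rho> b + lincomb \<rho> c"
  and lincomb_diff: "lincomb \<rho> (b - c) = lincomb \<rho> b - lincomb \<rho> c"
  by (simp_all add: vec_eq_iff lincomb_nth algebra_simps sum.distrib sum_subtractf)

lemma lincomb_scale: "lincomb \<rho> (t *s b) = t *s lincomb \<rho> b"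
  by (simp add: vec_eq_iff lincomb_nth sum_distrib_left mult.assoc)

lemma lincomb_axis [simp]: "lincomb \<rho> (axis i 1) = \<rho> $ i"
  by (simp add: vec_eq_iff lincomb_nth axis_def if_distrib[of "\<lambda>x. x * _"] cong: if_cong)

lemma span_image_nth:
  fixes \<rho> :: "('a::comm_ring_1^'n)^'m"
  shows "module.span (*s) (($) \<rho> ` J) = {lincomb \<rho> b | b. \<forall>i. i \<notin> J \<longrightarrow> b $ i = 0}"
    (is "?L = ?R")
proof
  have "module.subspace (*s) ?R"
  proof (rule module.subspaceI[OF module_vec])
    show "0 \<in> ?R"
      by (auto intro!: exI[of _ 0])
    show "u + v \<in> ?R" if uv: "u \<in> ?R" "v \<in> ?R" for u v
    proof -
      obtain b c where "u = lincomb \<rho> b" "v = lincomb \<rho> c" "\<forall>i. i \<notin> J \<longrightarrow> b $ i = 0 \<and> c $ i = 0"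
        using uv by auto
      then show ?thesis
        by (auto intro!: exI[of _ "b + c"] simp: lincomb_add)
    qed
    show "t *s u \<in> ?R" if u: "u \<in> ?R" for t u
    proof -
      obtain b where "u = lincomb \<rho> b" "\<forall>i. i \<notin> J \<longrightarrow> b $ i = 0"
        using u by auto
      then show ?thesis
        by (auto intro!: exI[of _ "t *s b"] simp: lincomb_scale)
    qed
  qed
  moreover have "($) \<rho> ` J \<subseteq> ?R"
  proof
    fix u assume "u \<in> ($) \<rho> ` J"
    then obtain j where "j \<in> J" "u = \<rho> $ j"
      by blast
    then show "u \<in> ?R"
      by (auto intro!: exI[of _ "axis j 1"] simp: axis_def simp flip: lincomb_axis)
  qed
  ultimately show "?L \<subseteq> ?R"
    by (intro module.span_minimal[OF module_vec])
  show "?R \<subseteq> ?L"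
  proof
    fix u assume "u \<in> ?R"
    then obtain b where b: "u = lincomb \<rho> b" "\<forall>i. i \<notin> J \<longrightarrow> b $ i = 0"
      by blast
    have "b $ i *s \<rho> $ i \<in> ?L" for i
    proof (cases "i \<in> J")
      case True
      then show ?thesis
        by (intro module.span_scale[OF module_vec] module.span_base[OF module_vec]) blast
    next
      case False
      then show ?thesis
        using b module.span_zero[OF module_vec] by auto
    qed
    then show "u \<in> ?L"
      unfolding b lincomb_def by (intro module.span_sum[OF module_vec])
  qed
qed

lemma span_range_nth: "module.span (*s) (range (($) \<rho>)) = range (lincomb \<rho>)"
  using span_image_nth[of \<rho> UNIV] by auto

section \<open>Partial derivatives and the rank of the syzygy module\<close>

lemma gradient_map_lincomb:
  "gradient_map f (lincomb \<rho> b) = (\<Sum>i\<in>UNIV. b $ i * gradient_map f (\<rho> $ i))"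
  unfolding gradient_map_def lincomb_nth
  by (simp add: sum_distrib_left sum_distrib_right mult.assoc) (rule sum.swap)

lemma lincomb_in_AR: "(\<And>i. \<rho> $ i \<in> AR f) \<Longrightarrow> lincomb \<rho> b \<in> AR f"
  by (simp add: AR_def gradient_map_lincomb)

text \<open>Monomials without the variable \<open>i\<close> contribute the coefficient 0, and on all
  others the truncated subtraction can be inverted.\<close>

lemma lookup_partial:
  "Poly_Mapping.lookup (partial i f) n =
     of_nat (Suc (Poly_Mapping.lookup n i)) * Poly_Mapping.lookup f (n + Poly_Mapping.single i 1)"
proof -
  let ?e = "Poly_Mapping.single i (1::nat)"
  have *: "m - ?e = n \<longleftrightarrow> m = n + ?e" if "Poly_Mapping.lookup m i \<noteq> 0" for m
  proof
    assume n: "m - ?e = n"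
    have "Poly_Mapping.lookup m j = Poly_Mapping.lookup (n + ?e) j" for j
      using that by (auto simp: lookup_add lookup_minus lookup_single when_def simp flip: n)
    then show "m = n + ?e"
      by (rule poly_mapping_eqI)
  qed simp
  have "Poly_Mapping.lookup (partial i f) n = (\<Sum>m\<in>Poly_Mapping.keys f.
      of_nat (Poly_Mapping.lookup m i) * Poly_Mapping.lookup f m when m - ?e = n)"
    by (simp add: partial_def lookup_sum lookup_single)
  also have "\<dots> = (\<Sum>m\<in>Poly_Mapping.keys f.
      if m = n + ?e then of_nat (Poly_Mapping.lookup m i) * Poly_Mapping.lookup f m else 0)"
  proof (rule sum.cong)
    fix m
    show "(of_nat (Poly_Mapping.lookup m i) * Poly_Mapping.lookup f m when m - ?e = n)
        = (if m = n + ?e then of_nat (Poly_Mapping.lookup m i) * Poly_Mapping.lookup f m else 0)"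
      using *[of m] by (cases "Poly_Mapping.lookup m i = 0") (auto simp: when_def)
  qed simp
  finally show ?thesis
    by (simp add: lookup_add in_keys_iff)
qed

text \<open>Characteristic 0: a monomial of positive degree contains some variable, and
  differentiation by it multiplies the coefficient by a nonzero integer.\<close>

lemma exists_partial_nonzero:
  assumes "homogeneous d f" "d \<noteq> 0" "f \<noteq> 0"
  shows "\<exists>i. partial i f \<noteq> 0"
proof -
  obtain m where m: "m \<in> Poly_Mapping.keys f"
    using assms(3) by (metis all_not_in_conv keys_eq_empty)
  with assms have "mdeg m \<noteq> 0"
    by (auto simp: homogeneous_def)
  then obtain i where i: "Poly_Mapping.lookup m i \<noteq> 0"
    unfolding mdeg_def by (meson sum.neutral)
  let ?e = "Poly_Mapping.single i (1::nat)"
  have "m - ?e + ?e = m"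
    by (rule poly_mapping_eqI) (use i in \<open>auto simp: lookup_add lookup_minus lookup_single when_def\<close>)
  then have "Poly_Mapping.lookup (partial i f) (m - ?e) \<noteq> 0"
    using m by (simp add: lookup_partial in_keys_iff del: of_nat_Suc)
  then show ?thesis
    by (metis lookup_zero)
qed

text \<open>All syzygies are orthogonal to the gradient, so \<open>AR f\<close> has rank at most 3.\<close>

lemma AR_exists_relation:
  fixes \<rho> :: "(S^4)^4"
  assumes "partial k f \<noteq> 0" and AR: "\<And>i. \<rho> $ i \<in> AR f"
  obtains b where "b \<noteq> 0" "lincomb \<rho> b = 0"
proof -
  \<comment> \<open>Only the three coordinates other than \<open>k\<close> are imposed, so the four
    vectors admit a relation on them.\<close>
  have "card (UNIV - {k}) < card (UNIV :: 4 set)"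
    by (simp add: card_Diff_singleton)
  then obtain c where c: "\<exists>i. c i \<noteq> 0" "\<forall>j\<in>UNIV - {k}. (\<Sum>i\<in>UNIV. c i * \<rho> $ i $ j) = 0"
    using exists_linear_relation[of "UNIV - {k}" "UNIV :: 4 set" "\<lambda>i j. \<rho> $ i $ j"] by auto
  define b where "b = (\<chi> i. c i)"
  have other: "lincomb \<rho> b $ j = 0" if "j \<noteq> k" for j
    using c(2) that by (simp add: lincomb_nth b_def)
  \<comment> \<open>Orthogonality to the gradient then forces the remaining coordinate to
    vanish.\<close>
  have "gradient_map f (lincomb \<rho> b) = lincomb \<rho> b $ k * partial k f"
    unfolding gradient_map_def by (subst sum.remove[of _ k]) (auto simp: other)
  then have "lincomb \<rho> b $ k = 0"
    using lincomb_in_AR[OF AR, of b] assms(1) by (simp add: AR_def)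
  with other have "lincomb \<rho> b = 0"
    by (metis vec_eq_iff zero_index)
  moreover have "b \<noteq> 0"
    using c(1) by (auto simp: b_def vec_eq_iff)
  ultimately show thesis
    using that by blast
qed

section \<open>Homogeneous coefficients for homogeneous syzygies\<close>

definition restrict_keys :: "('a \<Rightarrow> bool) \<Rightarrow> ('a \<Rightarrow>\<^sub>0 'b) \<Rightarrow> ('a \<Rightarrow>\<^sub>0 'b::comm_monoid_add)" where
  "restrict_keys P p =
     (\<Sum>m\<in>Poly_Mapping.keys p. Poly_Mapping.single m (Poly_Mapping.lookup p m when P m))"

lemma lookup_restrict_keys:
  "Poly_Mapping.lookup (restrict_keys P p) m = (Poly_Mapping.lookup p m when P m)"
proof -
  have "Poly_Mapping.lookup (restrict_keys P p) m = (\<Sum>n\<in>Poly_Mapping.keys p.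
      if n = m then (Poly_Mapping.lookup p m when P m) else 0)"
    unfolding restrict_keys_def lookup_sum
    by (rule sum.cong) (auto simp: lookup_single when_def)
  then show ?thesis
    by (simp add: in_keys_iff)
qed

lemma keys_sum_mult_mdeg:
  fixes b :: "S^'m"
  assumes "m \<in> Poly_Mapping.keys (\<Sum>i\<in>UNIV. b $ i * r i)" and "\<And>i. homogeneous (e $ i) (r i)"
  obtains i n where "n \<in> Poly_Mapping.keys (b $ i)" "mdeg m = mdeg n + e $ i"
proof -
  obtain i where "m \<in> Poly_Mapping.keys (b $ i * r i)"
    using assms(1) keys_sum[of "\<lambda>i. b $ i * r i" UNIV] by auto
  then obtain n n' where "m = n + n'" "n \<in> Poly_Mapping.keys (b $ i)" "n' \<in> Poly_Mapping.keys (r i)"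
    using keys_mult by blast
  then show thesis
    using assms(2)[of i] by (intro that) (auto simp: homogeneous_def mdeg_add)
qed

lemma graded_coefficients:
  fixes \<rho> :: "(S^4)^'m"
  assumes \<rho>: "\<And>i. \<rho> $ i \<in> AR_deg f (e $ i)" and \<sigma>: "lincomb \<rho> b \<in> AR_deg f q"
  obtains c where "c \<in> twisted_deg e q" "lincomb \<rho> c = lincomb \<rho> b"
proof -
  \<comment> \<open>The shifted condition is written additively, so that it selects nothing when
    \<open>q\<close> is below \<open>e $ i\<close>.\<close>
  define c where "c = (\<chi> i. restrict_keys (\<lambda>m. mdeg m + e $ i = q) (b $ i))"
  have c: "c \<in> twisted_deg e q"
    by (auto simp: twisted_deg_def c_def in_keys_iff lookup_restrict_keys)
  have hom: "homogeneous (e $ i) (\<rho> $ i $ j)" for i j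
    using \<rho> by (auto simp: AR_deg_def)
  have "lincomb \<rho> (b - c) $ j = 0" for j
  proof (rule ccontr)
    assume "lincomb \<rho> (b - c) $ j \<noteq> 0"
    then obtain m where m: "m \<in> Poly_Mapping.keys (lincomb \<rho> (b - c) $ j)"
      by (metis all_not_in_conv keys_eq_empty)
    then obtain i n where "n \<in> Poly_Mapping.keys ((b - c) $ i)" "mdeg m = mdeg n + e $ i"
      unfolding lincomb_nth by (rule keys_sum_mult_mdeg[OF _ hom])
    then have "mdeg m \<noteq> q"
      by (auto simp: c_def in_keys_iff lookup_restrict_keys lookup_minus when_def split: if_splits)
    moreover have "m \<in> Poly_Mapping.keys (lincomb \<rho> b $ j) \<union> Poly_Mapping.keys (lincomb \<rho> c $ j)"
      using m keys_diff[of "lincomb \<rho> b $ j" "lincomb \<rho> c $ j"] by (auto simp: lincomb_diff)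
    moreover have "mdeg m = q" if "m \<in> Poly_Mapping.keys (lincomb \<rho> b $ j)"
      using that \<sigma> by (auto simp: AR_deg_def homogeneous_def)
    moreover have "mdeg m = q" if "m \<in> Poly_Mapping.keys (lincomb \<rho> c $ j)"
    proof -
      obtain i n where "n \<in> Poly_Mapping.keys (c $ i)" "mdeg m = mdeg n + e $ i"
        using \<open>m \<in> Poly_Mapping.keys (lincomb \<rho> c $ j)\<close> unfolding lincomb_nth
        by (rule keys_sum_mult_mdeg[OF _ hom])
      with c show ?thesis
        by (auto simp: twisted_deg_def)
    qed
    ultimately show False
      by blast
  qed
  then have "lincomb \<rho> c = lincomb \<rho> b"
    by (simp add: vec_eq_iff lincomb_diff)
  with c show thesis
    by (rule that)
qed

lemma AR_deg_graded_coefficients: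
  fixes \<rho> :: "(S^4)^'m"
  assumes "\<And>i. \<rho> $ i \<in> AR_deg f (e $ i)" and "range (lincomb \<rho>) = AR f" and "\<sigma> \<in> AR_deg f q"
  shows "\<exists>c\<in>twisted_deg e q. \<sigma> = lincomb \<rho> c"
proof -
  have "\<sigma> \<in> range (lincomb \<rho>)"
    using assms by (simp add: AR_deg_def)
  then show ?thesis
    using assms(3) graded_coefficients[OF assms(1)] by (metis image_iff)
qed

lemma twisted_deg_le: "c \<in> twisted_deg e q \<Longrightarrow> c $ i \<noteq> 0 \<Longrightarrow> e $ i \<le> q"
  unfolding twisted_deg_def by (metis (mono_tags, lifting) all_not_in_conv keys_eq_empty le_add2 mem_Collect_eq)

lemma homogeneous_0_iff: "homogeneous 0 p \<longleftrightarrow> (\<exists>c. p = Const c)"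
proof
  assume "homogeneous 0 p"
  then have "m = 0" if "m \<in> Poly_Mapping.keys p" for m
    using that by (auto simp: homogeneous_def mdeg_eq_0_iff)
  then have "p = Const (Poly_Mapping.lookup p 0)"
    unfolding Const_def
    by (intro poly_mapping_eqI) (auto simp: lookup_single when_def in_keys_iff)
  then show "\<exists>c. p = Const c" ..
qed (auto simp: homogeneous_def Const_def split: if_splits)

text \<open>A nonzero coefficient at \<open>k\<close> forces degree at least \<open>e $ k\<close>,
  so bounds on the generators pass to all syzygies. Outside the span of the generator
  \<open>i\<close>, some other generator must occur.\<close>

lemma minimal_pairI:
  fixes \<rho> :: "(S^4)^'m"
  assumes \<rho>: "\<And>k. \<rho> $ k \<in> AR_deg f (e $ k)" and gen: "range (lincomb \<rho>) = AR f"
    and e: "e $ i \<le> e $ j" "\<And>k. k \<noteq> i \<Longrightarrow> e $ j \<le> e $ k"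
    and nz: "\<rho> $ i \<noteq> 0" "\<rho> $ j \<notin> module.span (*s) {\<rho> $ i}"
  shows "minimal_pair f (\<rho> $ i) (\<rho> $ j)"
proof -
  have ei: "e $ i \<le> e $ k" for k
    using e by (cases "k = i") (auto intro: order_trans)
  have coeffs: "\<exists>c\<in>twisted_deg e q. \<sigma> = lincomb \<rho> c" if "\<sigma> \<in> AR_deg f q" for q \<sigma>
    using AR_deg_graded_coefficients[OF \<rho> gen that] .
  have "e $ i \<le> q" if \<sigma>: "\<sigma> \<in> AR_deg f q" "\<sigma> \<noteq> 0" for q \<sigma>
  proof -
    obtain c where c: "c \<in> twisted_deg e q" "\<sigma> = lincomb \<rho> c"
      using coeffs[OF \<sigma>(1)] by blast
    then have "c \<noteq> 0"
      using \<sigma>(2) by auto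
    then obtain k where "c $ k \<noteq> 0"
      by (auto simp: vec_eq_iff)
    with c(1) ei[of k] show ?thesis
      by (meson order_trans twisted_deg_le)
  qed
  moreover have "e $ j \<le> q" if \<sigma>: "\<sigma> \<in> AR_deg f q" "\<sigma> \<notin> module.span (*s) {\<rho> $ i}" for q \<sigma>
  proof -
    obtain c where c: "c \<in> twisted_deg e q" "\<sigma> = lincomb \<rho> c"
      using coeffs[OF \<sigma>(1)] by blast
    have "\<exists>k. k \<noteq> i \<and> c $ k \<noteq> 0"
    proof (rule ccontr)
      assume "\<not> ?thesis"
      then have "\<sigma> \<in> module.span (*s) (($) \<rho> ` {i})"
        unfolding span_image_nth c by blast
      with \<sigma>(2) show False
        by simp
    qed
    then obtain k where "k \<noteq> i" "c $ k \<noteq> 0"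
      by blast
    with c(1) e(2)[of k] show ?thesis
      by (meson order_trans twisted_deg_le)
  qed
  ultimately show ?thesis
    unfolding minimal_pair_def using \<rho> e nz by blast
qed

section \<open>One-relator graded presentations\<close>

text \<open>A graded presentation of \<open>AR f\<close> with four generators and one relation of
  degree \<open>D\<close>. In contrast to \<open>second_syzygy\<close> it leaves the degrees general
  and does not mention minimality, which makes it easy to carry through changes of
  generators.\<close>

definition presentation :: "S \<Rightarrow> nat^4 \<Rightarrow> nat \<Rightarrow> (S^4)^4 \<Rightarrow> S^4 \<Rightarrow> bool" where
  "presentation f e D \<rho> a \<longleftrightarrow> range (lincomb \<rho>) = AR f \<and> (\<forall>i. \<rho> $ i \<in> AR_deg f (e $ i)) \<and>
     a \<in> twisted_deg e D \<and> {b. lincomb \<rho> b = 0} = range (\<lambda>t. t *s a)"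

lemma vector_4:
  "(vector [x, y, z, w] :: 'a::zero^4) $ 1 = x" "(vector [x, y, z, w] :: 'a::zero^4) $ 2 = y"
  "(vector [x, y, z, w] :: 'a::zero^4) $ 3 = z" "(vector [x, y, z, w] :: 'a::zero^4) $ 4 = w"
  unfolding vector_def by simp_all

text \<open>Minimality in usable form: entry \<open>i\<close> of \<open>a\<close> lives in the
  positive degree \<open>D - e $ i\<close>, so no multiple of \<open>a\<close> has a constant term
  there.\<close>

lemma presentation_relation_coeff:
  assumes "presentation f e D \<rho> a" "lincomb \<rho> b = 0" "e $ i < D"
  shows "Poly_Mapping.lookup (b $ i) 0 = 0"
proof (rule ccontr)
  assume "Poly_Mapping.lookup (b $ i) 0 \<noteq> 0"
  moreover obtain t where "b = t *s a"
    using assms unfolding presentation_def by blast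
  ultimately have "0 \<in> Poly_Mapping.keys (t * a $ i)"
    by (simp add: in_keys_iff)
  then obtain m n where mn: "0 = m + n" "n \<in> Poly_Mapping.keys (a $ i)"
    using keys_mult by blast
  then have "mdeg n = 0"
    by (metis add_is_0 mdeg_0 mdeg_add)
  moreover have "mdeg n + e $ i = D"
    using assms(1) mn(2) by (auto simp: presentation_def twisted_deg_def)
  ultimately show False
    using assms(3) by simp
qed

text \<open>Trades the truncated subtraction for the additive degree condition of
  \<open>twisted_deg\<close>; \<open>k \<le> q\<close> makes this exact.\<close>

lemma homogeneous_Suc_diff_iff:
  assumes "k \<le> q"
  shows "homogeneous (q - k + 1) p \<longleftrightarrow> (\<forall>m\<in>Poly_Mapping.keys p. mdeg m + k = q + 1)"
  using assms by (auto simp: homogeneous_def)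

text \<open>A redundant generator would give a relation with constant term 1 at its own
  index.\<close>

lemma presentation_minimal_generators:
  assumes "presentation f e D \<rho> a" "\<And>i. e $ i < D"
  shows "minimal_generators f \<rho>"
proof -
  have "module.span (*s) (($) \<rho> ` (UNIV - {j})) \<noteq> AR f" for j
  proof
    assume "module.span (*s) (($) \<rho> ` (UNIV - {j})) = AR f"
    moreover have "\<rho> $ j \<in> AR f"
      using assms(1) by (auto simp: presentation_def AR_deg_def)
    ultimately obtain b where b: "\<rho> $ j = lincomb \<rho> b" "b $ j = 0"
      unfolding span_image_nth by auto
    then have "lincomb \<rho> (axis j 1 - b) = 0"
      by (simp add: lincomb_diff)
    then have "Poly_Mapping.lookup ((axis j 1 - b) $ j) 0 = 0"
      by (rule presentation_relation_coeff[OF assms(1)]) (rule assms(2))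
    with b(2) show False
      by (simp add: axis_def)
  qed
  then show ?thesis
    using assms(1) by (simp add: minimal_generators_def span_range_nth presentation_def)
qed

text \<open>A relation of degree \<open>d3 + 1\<close> has entries of exactly the prescribed
  degrees, and minimality is automatic because all generators have degree at most
  \<open>d3\<close>.\<close>

lemma second_syzygy_iff_presentation:
  assumes "d1 \<le> d2" "d2 \<le> d3"
  shows "second_syzygy f d1 d2 d3 \<rho> a \<longleftrightarrow> presentation f (vector [d1, d2, d3, d3]) (d3 + 1) \<rho> a"
proof -
  let ?e = "vector [d1, d2, d3, d3] :: nat^4"
  have tw: "a \<in> twisted_deg ?e (d3 + 1) \<longleftrightarrow>
      homogeneous (d3 - d1 + 1) (a $ 1) \<and> homogeneous (d3 - d2 + 1) (a $ 2) \<and>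
      homogeneous 1 (a $ 3) \<and> homogeneous 1 (a $ 4)"
    using assms homogeneous_Suc_diff_iff[of d1 d3] homogeneous_Suc_diff_iff[of d2 d3]
    by (simp add: twisted_deg_def forall_4 vector_4) (simp add: homogeneous_def)
  have rel: "{b. (\<Sum>i\<in>UNIV. b $ i *s \<rho> $ i) = 0} = module.span (*s) {a} \<longleftrightarrow>
      {b. lincomb \<rho> b = 0} = range (\<lambda>t. t *s a)"
    by (simp add: lincomb_def module.span_singleton[OF module_vec])
  have "minimal_generators f \<rho> \<Longrightarrow> range (lincomb \<rho>) = AR f"
    by (simp add: minimal_generators_def span_range_nth)
  moreover have "presentation f ?e (d3 + 1) \<rho> a \<Longrightarrow> minimal_generators f \<rho>"
  proof (elim presentation_minimal_generators)
    show "?e $ i < d3 + 1" for i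
      using assms exhaust_4[of i] by (auto simp: vector_4)
  qed
  ultimately show ?thesis
    unfolding second_syzygy_def rel using tw
    by (auto simp: presentation_def forall_4 vector_4)
qed

text \<open>Vanishing of the first generator, or the second being a multiple of it, would be a
  relation with an entry 1, while no relation has a constant term.\<close>

lemma presentation_minimal_pair:
  assumes pr: "presentation f e D \<rho> a"
    and e: "e $ 1 \<le> e $ 2" "e $ 2 \<le> e $ 3" "e $ 4 = e $ 3" "D = e $ 3 + 1"
  shows "minimal_pair f (\<rho> $ 1) (\<rho> $ 2)"
proof (rule minimal_pairI[where e = e])
  show "\<rho> $ k \<in> AR_deg f (e $ k)" for k
    using pr by (simp add: presentation_def)
  show "range (lincomb \<rho>) = AR f"
    using pr by (simp add: presentation_def)
  show "e $ 2 \<le> e $ k" if "k \<noteq> 1" for k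
    using e that exhaust_4[of k] by auto
  show "\<rho> $ 1 \<noteq> 0"
  proof
    assume "\<rho> $ 1 = 0"
    then have "lincomb \<rho> (axis 1 1) = 0"
      by simp
    then have "Poly_Mapping.lookup ((axis 1 1 :: S^4) $ 1) 0 = 0"
      by (rule presentation_relation_coeff[OF pr]) (use e in simp)
    then show False
      by (simp add: axis_def)
  qed
  show "\<rho> $ 2 \<notin> module.span (*s) {\<rho> $ 1}"
  proof
    assume "\<rho> $ 2 \<in> module.span (*s) {\<rho> $ 1}"
    then obtain t where "\<rho> $ 2 = t *s \<rho> $ 1"
      by (auto simp: module.span_singleton[OF module_vec])
    then have "lincomb \<rho> (axis 2 1 - t *s axis 1 1) = 0"
      by (simp add: lincomb_diff lincomb_scale)
    then have "Poly_Mapping.lookup ((axis 2 1 - t *s axis 1 1 :: S^4) $ 2) 0 = 0"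
      by (rule presentation_relation_coeff[OF pr]) (use e in simp)
    then show False
      by (simp add: axis_def)
  qed
qed (use e in auto)

section \<open>Changes of generators within one degree\<close>

lemma presentation_swap:
  assumes pr: "presentation f e D \<rho> a" and e: "e $ i = e $ j"
  shows "presentation f e D (\<chi> k. \<rho> $ Transposition.transpose i j k)
     (\<chi> k. a $ Transposition.transpose i j k)"
proof -
  let ?\<tau> = "Transposition.transpose i j"
  let ?T = "\<lambda>b::S^4. \<chi> k. b $ ?\<tau> k"
  have TT: "?T (?T b) = b" for b
    by (simp add: vec_eq_iff)
  have e': "e $ ?\<tau> k = e $ k" for k
    using e by (auto simp: Transposition.transpose_def)
  have lin: "lincomb (\<chi> k. \<rho> $ ?\<tau> k) b = lincomb \<rho> (?T b)" for b
    unfolding lincomb_def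
    by (rule sum.reindex_bij_witness[where i = ?\<tau> and j = ?\<tau>]) simp_all
  have "range (lincomb (\<chi> k. \<rho> $ ?\<tau> k)) = range (lincomb \<rho>)"
  proof (intro equalityI subsetI)
    fix u assume "u \<in> range (lincomb \<rho>)"
    then obtain b where "u = lincomb \<rho> b"
      by blast
    then have "u = lincomb (\<chi> k. \<rho> $ ?\<tau> k) (?T b)"
      unfolding lin TT .
    then show "u \<in> range (lincomb (\<chi> k. \<rho> $ ?\<tau> k))"
      by blast
  qed (auto simp: lin)
  moreover have "\<rho> $ ?\<tau> k \<in> AR_deg f (e $ ?\<tau> k)" for k
    using pr by (simp add: presentation_def)
  then have "\<rho> $ ?\<tau> k \<in> AR_deg f (e $ k)" for k
    by (simp add: e')
  moreover have "mdeg m + e $ ?\<tau> k = D" if "m \<in> Poly_Mapping.keys (a $ ?\<tau> k)" for m k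
    using pr that by (simp add: presentation_def twisted_deg_def)
  then have "?T a \<in> twisted_deg e D"
    by (simp add: twisted_deg_def e')
  moreover have "{b. lincomb (\<chi> k. \<rho> $ ?\<tau> k) b = 0} = range (\<lambda>t. t *s ?T a)"
  proof -
    have "lincomb \<rho> (?T b) = 0 \<longleftrightarrow> (\<exists>t. ?T b = t *s a)" for b
      using pr unfolding presentation_def by blast
    moreover have "?T b = t *s a \<longleftrightarrow> b = t *s ?T a" for b t
    proof -
      have "?T (t *s a) = t *s ?T a"
        by (simp add: vec_eq_iff)
      then show ?thesis
        using TT by metis
    qed
    ultimately show ?thesis
      by (auto simp: lin)
  qed
  ultimately show ?thesis
    using pr unfolding presentation_def by simp
qed

text \<open>By degree, \<open>c $ i\<close> is a nonzero constant, so the replacement is an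
  invertible change of coordinates. Transporting the relation along it alters, apart from entry
  \<open>i\<close>, only entries at which \<open>c\<close> is nonzero.\<close>

lemma presentation_replace:
  assumes pr: "presentation f e D \<rho> a"
    and c: "c \<in> twisted_deg e (e $ i)" "c $ i \<noteq> 0" and \<sigma>: "lincomb \<rho> c \<in> AR_deg f (e $ i)"
  obtains a' where "presentation f e D (\<chi> k. if k = i then lincomb \<rho> c else \<rho> $ k) a'"
    and "\<And>k. k \<noteq> i \<Longrightarrow> c $ k = 0 \<Longrightarrow> a' $ k = a $ k"
proof -
  have "homogeneous 0 (c $ i)"
    using c(1) by (fastforce simp: twisted_deg_def homogeneous_def)
  then obtain \<gamma> where \<gamma>: "c $ i = Const \<gamma>"
    unfolding homogeneous_0_iff by blast
  define u where "u = Const (1 / \<gamma>)"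
  have u: "u * c $ i = 1"
    using c(2) by (simp add: u_def \<gamma> flip: Const_mult)
  let ?\<rho> = "\<chi> k. if k = i then lincomb \<rho> c else \<rho> $ k"
  \<comment> \<open>\<open>h\<close> turns coefficients for the new generators into coefficients for
    the old ones, and \<open>g\<close> is its inverse.\<close>
  define h where "h b = b $ i *s c + (\<chi> k. if k = i then 0 else b $ k)" for b :: "S^4"
  define g where "g b = (\<chi> k. if k = i then u * b $ i else b $ k - u * b $ i * c $ k)" for b :: "S^4"
  have hg: "h (g b) = b" for b
    using u by (simp add: h_def g_def vec_eq_iff algebra_simps)
  have gh: "g (h b) = b" for b
    using u by (simp add: h_def g_def vec_eq_iff algebra_simps)
  have g_scale: "g (t *s b) = t *s g b" for t b
    by (simp add: g_def vec_eq_iff algebra_simps)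
  have lin: "lincomb ?\<rho> b = lincomb \<rho> (h b)" for b
  proof -
    have "lincomb ?\<rho> b = b $ i *s lincomb \<rho> c + (\<Sum>k\<in>UNIV - {i}. b $ k *s \<rho> $ k)"
      unfolding lincomb_def[of ?\<rho>] by (subst sum.remove[of _ i]) auto
    moreover have "lincomb \<rho> (\<chi> k. if k = i then 0 else b $ k) = (\<Sum>k\<in>UNIV - {i}. b $ k *s \<rho> $ k)"
      unfolding lincomb_def by (subst sum.remove[of _ i]) auto
    ultimately show ?thesis
      by (simp add: h_def lincomb_add lincomb_scale)
  qed
  have "range (lincomb ?\<rho>) = range (lincomb \<rho>)"
  proof (intro equalityI subsetI)
    fix v assume "v \<in> range (lincomb \<rho>)"
    then obtain b where "v = lincomb \<rho> b"
      by blast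
    then have "v = lincomb ?\<rho> (g b)"
      unfolding lin hg .
    then show "v \<in> range (lincomb ?\<rho>)"
      by blast
  qed (auto simp: lin)
  moreover have "?\<rho> $ k \<in> AR_deg f (e $ k)" for k
    using pr \<sigma> by (simp add: presentation_def)
  \<comment> \<open>The correction at \<open>k\<close> has degree
    \<open>(D - e $ i) + (e $ i - e $ k)\<close>, so the relation keeps degree
    \<open>D\<close>.\<close>
  moreover have "g a \<in> twisted_deg e D"
  proof -
    have a: "mdeg m + e $ k = D" if "m \<in> Poly_Mapping.keys (a $ k)" for m k
      using pr that by (auto simp: presentation_def twisted_deg_def)
    have ua: "mdeg m + e $ i = D" if "m \<in> Poly_Mapping.keys (u * a $ i)" for m
    proof -
      obtain n n' where "m = n + n'" "n \<in> Poly_Mapping.keys u" "n' \<in> Poly_Mapping.keys (a $ i)"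
        using \<open>m \<in> Poly_Mapping.keys (u * a $ i)\<close> keys_mult by blast
      then show ?thesis
        using a by (auto simp: u_def Const_def split: if_splits)
    qed
    have "mdeg m + e $ k = D" if "m \<in> Poly_Mapping.keys (u * a $ i * c $ k)" for m k
    proof -
      obtain n n' where n: "m = n + n'" "n \<in> Poly_Mapping.keys (u * a $ i)"
          "n' \<in> Poly_Mapping.keys (c $ k)"
        using \<open>m \<in> Poly_Mapping.keys (u * a $ i * c $ k)\<close> keys_mult by blast
      moreover have "mdeg n' + e $ k = e $ i"
        using c(1) n by (auto simp: twisted_deg_def)
      ultimately show ?thesis
        using ua[of n] by (simp add: mdeg_add)
    qed
    moreover have "Poly_Mapping.keys (a $ k - u * a $ i * c $ k) \<subseteq>
        Poly_Mapping.keys (a $ k) \<union> Poly_Mapping.keys (u * a $ i * c $ k)" for k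
      by (rule keys_diff)
    ultimately have "mdeg m + e $ k = D" if "m \<in> Poly_Mapping.keys (a $ k - u * a $ i * c $ k)" for m k
      using that a by blast
    with ua show ?thesis
      by (auto simp: twisted_deg_def g_def)
  qed
  moreover have "{b. lincomb ?\<rho> b = 0} = range (\<lambda>t. t *s g a)"
  proof -
    have "lincomb \<rho> (h b) = 0 \<longleftrightarrow> (\<exists>t. h b = t *s a)" for b
      using pr unfolding presentation_def by blast
    moreover have "h b = t *s a \<longleftrightarrow> b = t *s g a" for b t
      using gh hg g_scale by metis
    ultimately show ?thesis
      by (auto simp: lin)
  qed
  ultimately have "presentation f e D ?\<rho> (g a)"
    using pr unfolding presentation_def by simp
  then show thesis
    by (rule that) (simp add: g_def)
qed

text \<open>This replaces graded Nakayama: the relation is followed through the change of generators,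
  which keeps control of its coefficients.\<close>

lemma presentation_exchange:
  assumes pr: "presentation f e D \<rho> a" and \<sigma>: "lincomb \<rho> c \<in> AR_deg f (e $ j)"
    and c: "c \<in> twisted_deg e (e $ j)" "c $ i \<noteq> 0" and e: "e $ i = e $ j"
  shows "\<exists>\<rho>' a'. presentation f e D \<rho>' a' \<and> \<rho>' $ j = lincomb \<rho> c \<and>
    (\<forall>k. k \<noteq> i \<longrightarrow> k \<noteq> j \<longrightarrow> \<rho>' $ k = \<rho> $ k) \<and> (\<forall>k. e $ j < e $ k \<longrightarrow> a' $ k = a $ k)"
proof -
  let ?\<tau> = "Transposition.transpose i j"
  let ?\<rho> = "\<chi> k. \<rho> $ ?\<tau> k" and ?c = "\<chi> k. c $ ?\<tau> k"
  \<comment> \<open>The generator to be given up is first moved to position \<open>j\<close>, which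
    then receives the new syzygy.\<close>
  have pr': "presentation f e D ?\<rho> (\<chi> k. a $ ?\<tau> k)"
    using pr e by (rule presentation_swap)
  have lin: "lincomb ?\<rho> ?c = lincomb \<rho> c"
    unfolding lincomb_def
    by (rule sum.reindex_bij_witness[where i = ?\<tau> and j = ?\<tau>]) simp_all
  have e': "e $ ?\<tau> k = e $ k" for k
    using e by (auto simp: Transposition.transpose_def)
  have "mdeg m + e $ ?\<tau> k = e $ j" if "m \<in> Poly_Mapping.keys (c $ ?\<tau> k)" for m k
    using c(1) that by (simp add: twisted_deg_def)
  then have "?c \<in> twisted_deg e (e $ j)"
    by (simp add: twisted_deg_def e')
  then obtain a' where a': "presentation f e D (\<chi> k. if k = j then lincomb \<rho> c else ?\<rho> $ k) a'"
      "\<And>k. k \<noteq> j \<Longrightarrow> ?c $ k = 0 \<Longrightarrow> a' $ k = (\<chi> k. a $ ?\<tau> k) $ k"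
    using presentation_replace[OF pr', of ?c j] c(2) \<sigma> unfolding lin by auto
  \<comment> \<open>A generator of degree above \<open>e $ j\<close> cannot occur in a syzygy of
    degree \<open>e $ j\<close>.\<close>
  have "a' $ k = a $ k" if "e $ j < e $ k" for k
  proof -
    have "k \<noteq> j" "k \<noteq> i"
      using that e by auto
    moreover have "c $ k = 0"
      using twisted_deg_le[OF c(1), of k] that by fastforce
    ultimately show ?thesis
      using a'(2)[of k] by simp
  qed
  with a'(1) show ?thesis
    by (intro exI conjI) auto
qed

text \<open>Two exchanges, first for \<sigma>1 and then for \<sigma>2. Both concern generators of
  degree at most \<open>e $ 2\<close>, so the entries 3 and 4 of the relation survive if these have
  larger degree.\<close>

lemma presentation_extend_minimal_pair:
  assumes pr: "presentation f e D \<rho> a"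
    and e: "e $ 1 \<le> e $ 2" "e $ 2 \<le> e $ 3" "e $ 4 = e $ 3" "D = e $ 3 + 1"
    and \<sigma>: "minimal_pair f \<sigma>1 \<sigma>2"
  obtains \<rho>' a' where "presentation f e D \<rho>' a'" "\<rho>' $ 1 = \<sigma>1" "\<rho>' $ 2 = \<sigma>2"
    and "e $ 2 < e $ 3 \<Longrightarrow> a' $ 3 = a $ 3 \<and> a' $ 4 = a $ 4"
proof -
  obtain e1 e2 where e1: "\<sigma>1 \<in> AR_deg f e1" "\<sigma>1 \<noteq> 0" "\<And>q \<tau>. \<tau> \<in> AR_deg f q \<Longrightarrow> \<tau> \<noteq> 0 \<Longrightarrow> e1 \<le> q"
    and e2: "\<sigma>2 \<in> AR_deg f e2" "\<sigma>2 \<notin> module.span (*s) {\<sigma>1}"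
      "\<And>q \<tau>. \<tau> \<in> AR_deg f q \<Longrightarrow> \<tau> \<notin> module.span (*s) {\<sigma>1} \<Longrightarrow> e2 \<le> q"
    using \<sigma> unfolding minimal_pair_def by blast
  have coeffs: "\<exists>c\<in>twisted_deg e q. \<tau> = lincomb \<rho> c"
    if "presentation f e D \<rho> a" "\<tau> \<in> AR_deg f q" for \<rho> a \<tau> q
    using that AR_deg_graded_coefficients unfolding presentation_def by blast
  have le: "e $ 1 \<le> e $ k" "k \<noteq> 1 \<Longrightarrow> e $ 2 \<le> e $ k" for k
    using e exhaust_4[of k] by auto
  \<comment> \<open>The least degree is determined: this bound comes from the minimality of
    \<sigma>1, the reverse one from a nonzero coefficient in its expansion.\<close>
  have "e1 \<le> e $ 1"
    using presentation_minimal_pair[OF pr e] e1(3) pr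
    unfolding minimal_pair_def presentation_def by blast
  obtain c where c: "c \<in> twisted_deg e e1" "\<sigma>1 = lincomb \<rho> c"
    using coeffs[OF pr e1(1)] by blast
  then have "c \<noteq> 0"
    using e1(2) by auto
  then obtain i where i: "c $ i \<noteq> 0"
    by (auto simp: vec_eq_iff)
  then have "e $ i \<le> e1"
    using twisted_deg_le c(1) by blast
  with \<open>e1 \<le> e $ 1\<close> le(1)[of i] have ei: "e1 = e $ 1" "e $ i = e $ 1"
    by auto
  have "lincomb \<rho> c \<in> AR_deg f (e $ 1)" "c \<in> twisted_deg e (e $ 1)"
    using c e1(1) ei by simp_all
  then obtain \<rho>' a' where pr': "presentation f e D \<rho>' a'" and "\<rho>' $ 1 = lincomb \<rho> c"
    and a': "\<And>k. e $ 1 < e $ k \<Longrightarrow> a' $ k = a $ k"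
    using presentation_exchange[OF pr _ _ i ei(2)] by blast
  then have \<rho>'1: "\<rho>' $ 1 = \<sigma>1"
    using c by simp
  \<comment> \<open>Compared with the new system, whose first generator is \<sigma>1 and whose
    second one therefore lies outside the span of \<sigma>1.\<close>
  have "e2 \<le> e $ 2"
    using presentation_minimal_pair[OF pr' e] e2(3) pr'
    unfolding minimal_pair_def presentation_def \<rho>'1 by blast
  obtain c' where c': "c' \<in> twisted_deg e e2" "\<sigma>2 = lincomb \<rho>' c'"
    using coeffs[OF pr' e2(1)] by blast
  have "\<exists>k. k \<noteq> 1 \<and> c' $ k \<noteq> 0"
  proof (rule ccontr)
    assume "\<not> ?thesis"
    then have "\<sigma>2 \<in> module.span (*s) (($) \<rho>' ` {1})"
      unfolding span_image_nth c' by blast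
    with e2(2) show False
      by (simp add: \<rho>'1)
  qed
  then obtain k where k: "k \<noteq> 1" "c' $ k \<noteq> 0"
    by blast
  then have "e $ k \<le> e2"
    using twisted_deg_le c'(1) by blast
  with \<open>e2 \<le> e $ 2\<close> le(2)[of k] k(1) have ek: "e2 = e $ 2" "e $ k = e $ 2"
    by auto
  have "lincomb \<rho>' c' \<in> AR_deg f (e $ 2)" "c' \<in> twisted_deg e (e $ 2)"
    using c' e2(1) ek by simp_all
  \<comment> \<open>As \<open>k\<close> is not 1, this exchange leaves \<sigma>1 in place.\<close>
  then obtain \<rho>'' a'' where pr'': "presentation f e D \<rho>'' a''" and \<rho>'': "\<rho>'' $ 2 = lincomb \<rho>' c'"
    "\<And>l. l \<noteq> k \<Longrightarrow> l \<noteq> 2 \<Longrightarrow> \<rho>'' $ l = \<rho>' $ l"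
    and a'': "\<And>l. e $ 2 < e $ l \<Longrightarrow> a'' $ l = a' $ l"
    using presentation_exchange[OF pr' _ _ k(2) ek(2)] by blast
  show thesis
  proof (rule that[OF pr''])
    show "\<rho>'' $ 1 = \<sigma>1"
      using \<rho>''(2)[of 1] k(1) \<rho>'1 by simp
    show "\<rho>'' $ 2 = \<sigma>2"
      using \<rho>''(1) c'(2) by simp
    show "a'' $ 3 = a $ 3 \<and> a'' $ 4 = a $ 4" if "e $ 2 < e $ 3"
      using that e a' a'' by simp
  qed
qed

section \<open>The tameness criterion for the first two generators\<close>

lemma tame_wrt_iff_lin_indep2:
  assumes pr: "presentation f e D \<rho> a"
    and e: "e $ 1 \<le> e $ 2" "e $ 2 \<le> e $ 3" "e $ 4 = e $ 3" "D = e $ 3 + 1"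
    and f: "partial k f \<noteq> 0"
  shows "tame_wrt f (\<rho> $ 1) (\<rho> $ 2) \<longleftrightarrow> lin_indep2 (a $ 3) (a $ 4)"
proof -
  have gen: "range (lincomb \<rho>) = AR f" and rel: "\<And>b. lincomb \<rho> b = 0 \<longleftrightarrow> (\<exists>t. b = t *s a)"
    using pr by (auto simp: presentation_def)
  have AR: "\<rho> $ i \<in> AR f" for i
    using pr by (simp add: presentation_def AR_deg_def)
  have lin4: "lincomb \<rho> b = b $ 1 *s \<rho> $ 1 + b $ 2 *s \<rho> $ 2 + b $ 3 *s \<rho> $ 3 + b $ 4 *s \<rho> $ 4" for b
    by (simp add: lincomb_def sum_4)
  have linear: "homogeneous 1 (a $ 3)" "homogeneous 1 (a $ 4)"
  proof -
    have "mdeg m + e $ i = D" if "m \<in> Poly_Mapping.keys (a $ i)" for m i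
      using pr that by (auto simp: presentation_def twisted_deg_def)
    from this[of _ 3] this[of _ 4] show "homogeneous 1 (a $ 3)" "homogeneous 1 (a $ 4)"
      using e by (auto simp: homogeneous_def)
  qed
  \<comment> \<open>Four syzygies are always dependent. This makes the dependence built from
    \<open>a\<close> below nontrivial.\<close>
  have "a \<noteq> 0"
  proof -
    obtain b where "b \<noteq> 0" "lincomb \<rho> b = 0"
      using AR_exists_relation[OF f AR] by blast
    then show ?thesis
      by (auto simp: rel)
  qed
  have "(\<forall>\<sigma>\<in>AR f. lin_dep3 (\<rho> $ 1) (\<rho> $ 2) \<sigma> \<longrightarrow> (\<exists>s t. \<sigma> = s *s \<rho> $ 1 + t *s \<rho> $ 2)) \<longleftrightarrow>
      lin_indep2 (a $ 3) (a $ 4)" (is "?exact \<longleftrightarrow> _")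
  proof
    assume indep: "lin_indep2 (a $ 3) (a $ 4)"
    show ?exact
    proof (intro ballI impI)
      fix \<sigma> assume "\<sigma> \<in> AR f" "lin_dep3 (\<rho> $ 1) (\<rho> $ 2) \<sigma>"
      then obtain x y z c where xyz: "x \<noteq> 0 \<or> y \<noteq> 0 \<or> z \<noteq> 0" and
        dep: "x *s \<rho> $ 1 + y *s \<rho> $ 2 + z *s \<sigma> = 0" and c: "\<sigma> = lincomb \<rho> c"
        using gen unfolding lin_dep3_def by blast
      have "lincomb \<rho> (x *s axis 1 1 + y *s axis 2 1 + z *s c) = 0"
        using dep by (simp add: lincomb_add lincomb_scale c)
      then obtain t where t: "x *s axis 1 1 + y *s axis 2 1 + z *s c = t *s a"
        using rel by blast
      have t1: "x + z * c $ 1 = t * a $ 1" and t2: "y + z * c $ 2 = t * a $ 2"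
        and t3: "z * c $ 3 = t * a $ 3" and t4: "z * c $ 4 = t * a $ 4"
        using t by (simp_all only: vec_eq_iff forall_4) (simp_all add: axis_def)
      have "a $ 3 \<noteq> 0"
        using indep unfolding lin_indep2_def
        by (metis Const_0 Const_1 add_0 mult_zero_left mult_zero_right zero_neq_one)
      \<comment> \<open>Otherwise entry 3 gives \<open>t = 0\<close> and the dependence is
        trivial.\<close>
      have "z \<noteq> 0"
      proof
        assume "z = 0"
        with t3 \<open>a $ 3 \<noteq> 0\<close> have "t = 0"
          by simp
        with t1 t2 \<open>z = 0\<close> have "x = 0" "y = 0"
          by simp_all
        with xyz \<open>z = 0\<close> show False
          by simp
      qed
      moreover have "z * c $ 3 * a $ 4 = z * c $ 4 * a $ 3"
        unfolding t3 t4 by (simp only: mult_ac)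
      then have "z * (c $ 3 * a $ 4) = z * (c $ 4 * a $ 3)"
        by (simp only: mult.assoc)
      ultimately have "c $ 3 * a $ 4 = c $ 4 * a $ 3"
        by simp
      then obtain h where h: "c $ 3 = h * a $ 3" "c $ 4 = h * a $ 4"
        using linear_forms_coprime[OF linear indep] by blast
      \<comment> \<open>Subtracting \<open>h\<close> times the relation leaves \<sigma> unchanged
        and clears its coefficients 3 and 4.\<close>
      have "lincomb \<rho> (h *s a) = 0"
        using rel by blast
      then have "\<sigma> = lincomb \<rho> (c - h *s a)"
        by (simp add: c lincomb_diff)
      then have "\<sigma> = (c $ 1 - h * a $ 1) *s \<rho> $ 1 + (c $ 2 - h * a $ 2) *s \<rho> $ 2"
        by (simp add: lin4 h)
      then show "\<exists>s t. \<sigma> = s *s \<rho> $ 1 + t *s \<rho> $ 2"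
        by blast
    qed
  next
    assume exact: ?exact
    show "lin_indep2 (a $ 3) (a $ 4)"
      unfolding lin_indep2_def
    proof (rule ccontr, clarsimp)
      fix x y assume xy: "Const x * a $ 3 + Const y * a $ 4 = 0" "x = 0 \<longrightarrow> y \<noteq> 0"
      have inv: "p = p * Const (1 / z) * Const z" if "z \<noteq> 0" for p z
        using that by (simp add: mult.assoc flip: Const_mult)
      \<comment> \<open>Both linear forms are constant multiples of one form \<open>t\<close>, found
        by dividing by whichever of \<open>x\<close> and \<open>y\<close> is nonzero.\<close>
      obtain t where t: "a $ 3 = t * Const y" "a $ 4 = - (t * Const x)"
      proof (cases "y = 0")
        case False
        have "a $ 4 * Const y = - (a $ 3 * Const x)"
          using xy(1) by (simp add: mult.commute add_eq_0_iff)
        then have "a $ 4 * Const y * Const (1 / y) = - (a $ 3 * Const (1 / y) * Const x)"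
          by (simp add: mult_ac)
        then have "a $ 4 = - (a $ 3 * Const (1 / y) * Const x)"
          using inv[OF False, of "a $ 4"] by (metis mult.assoc mult.commute)
        then show thesis
          using that inv[OF False] by blast
      next
        case True
        then have x: "x \<noteq> 0"
          using xy(2) by blast
        then show thesis
          using that[of "- (a $ 4 * Const (1 / x))"] inv[OF x, of "a $ 4"] xy(1) True by simp
      qed
      \<comment> \<open>With this choice, generators 3 and 4 enter the relation as
        \<open>t *s \<sigma>\<close>, which exhibits the dependence of \<sigma> on the first
        two.\<close>
      define \<sigma> where "\<sigma> = Const y *s \<rho> $ 3 - Const x *s \<rho> $ 4"
      have "\<sigma> = Const y *s \<rho> $ 3 + (- Const x) *s \<rho> $ 4"
        by (simp add: \<sigma>_def vec_eq_iff)
      then have "\<sigma> \<in> AR f"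
        by (simp only: AR_add AR_scale AR)
      moreover have "lin_dep3 (\<rho> $ 1) (\<rho> $ 2) \<sigma>"
        unfolding lin_dep3_def
      proof (intro exI conjI)
        have "lincomb \<rho> a = 0"
          using rel by (metis vector_smult_lid)
        moreover have "t *s \<sigma> = a $ 3 *s \<rho> $ 3 + a $ 4 *s \<rho> $ 4"
          by (simp add: \<sigma>_def t vec_eq_iff algebra_simps)
        ultimately show "a $ 1 *s \<rho> $ 1 + a $ 2 *s \<rho> $ 2 + t *s \<sigma> = 0"
          by (simp add: lin4 add.assoc)
        show "a $ 1 \<noteq> 0 \<or> a $ 2 \<noteq> 0 \<or> t \<noteq> 0"
          using \<open>a \<noteq> 0\<close> t by (auto simp: vec_eq_iff forall_4)
      qed
      ultimately obtain r s where "\<sigma> = r *s \<rho> $ 1 + s *s \<rho> $ 2"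
        using exact by blast
      \<comment> \<open>Such an expression is a relation with the constants \<open>y\<close> and
        \<open>- x\<close> at 3 and 4, but both entries of a relation have constant term 0.\<close>
      then have "lincomb \<rho> (Const y *s axis 3 1 - Const x *s axis 4 1 - r *s axis 1 1 - s *s axis 2 1) = 0"
        (is "lincomb \<rho> ?b = 0")
        by (simp add: lincomb_diff lincomb_scale \<sigma>_def)
      moreover have "e $ 3 < D" "e $ 4 < D"
        using e by simp_all
      ultimately have "Poly_Mapping.lookup (?b $ 3) 0 = 0" "Poly_Mapping.lookup (?b $ 4) 0 = 0"
        by (blast intro: presentation_relation_coeff[OF pr])+
      then show False
        using xy(2) by (simp add: axis_def Const_def)
    qed
  qed
  then show ?thesis
    unfolding tame_wrt_def tame_sequence_exact_iff[OF AR AR]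
    using presentation_minimal_pair[OF pr e] by simp
qed

section \<open>Free and nearly free surfaces\<close>

text \<open>Turns the abstract homomorphisms in the definitions of free and nearly free surfaces
  into explicit generators, the images of the unit vectors.\<close>

lemma module_hom_eq_lincomb:
  fixes \<phi> :: "'a::comm_ring_1^'m \<Rightarrow> 'a^'n"
  assumes "module_hom (*s) (*s) \<phi>"
  shows "\<phi> v = lincomb (\<chi> i. \<phi> (axis i 1)) v"
proof -
  have "\<phi> v = \<phi> (\<Sum>i\<in>UNIV. v $ i *s axis i 1)"
    by (simp add: basis_expansion)
  also have "\<dots> = (\<Sum>i\<in>UNIV. v $ i *s \<phi> (axis i 1))"
    by (simp add: module_hom.sum[OF assms] module_hom.scale[OF assms])
  finally show ?thesis
    by (simp add: lincomb_def)
qed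

lemma axis_in_twisted_deg: "axis i 1 \<in> twisted_deg e (e $ i)"
  by (simp add: twisted_deg_def axis_def)

lemma free_surface_imp_tame:
  assumes "free_surface f"
  shows "tame f"
proof -
  obtain d1 d2 d3 \<phi> where d: "d1 \<le> d2" "d2 \<le> d3" and
    hom: "module_hom (*s) (*s) \<phi>" and bij: "bij_betw \<phi> (UNIV :: (S^3) set) (AR f)" and
    deg: "\<And>q. \<phi> ` twisted_deg (vector [d1, d2, d3]) q = AR_deg f q"
    using assms unfolding free_surface_def by blast
  define e :: "nat^3" where "e = vector [d1, d2, d3]"
  define \<rho> :: "(S^4)^3" where "\<rho> = (\<chi> i. \<phi> (axis i 1))"
  have \<phi>: "\<phi> = lincomb \<rho>"
    unfolding \<rho>_def by (rule ext) (rule module_hom_eq_lincomb[OF hom])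
  have gen: "range (lincomb \<rho>) = AR f" and "inj (lincomb \<rho>)"
    using bij unfolding \<phi> bij_betw_def by auto
  then have zero: "b = 0" if "lincomb \<rho> b = 0" for b
    using that injD[of "lincomb \<rho>" b 0] by simp
  have \<rho>: "\<rho> $ i \<in> AR_deg f (e $ i)" for i
    using deg[of "e $ i"] axis_in_twisted_deg[of i e] by (force simp: \<rho>_def e_def)
  have "minimal_pair f (\<rho> $ 1) (\<rho> $ 2)"
  proof (rule minimal_pairI[OF \<rho> gen])
    show "e $ 1 \<le> e $ 2"
      using d by (simp add: e_def)
    show "e $ 2 \<le> e $ k" if "k \<noteq> 1" for k
      using d that exhaust_3[of k] by (auto simp: e_def)
    show "\<rho> $ 1 \<noteq> 0"
    proof
      assume "\<rho> $ 1 = 0"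
      then have "axis 1 1 = (0 :: S^3)"
        using zero[of "axis 1 1"] by simp
      then show False
        by (simp add: axis_eq_0_iff)
    qed
    show "\<rho> $ 2 \<notin> module.span (*s) {\<rho> $ 1}"
    proof
      assume "\<rho> $ 2 \<in> module.span (*s) {\<rho> $ 1}"
      then obtain t where "\<rho> $ 2 = t *s \<rho> $ 1"
        by (auto simp: module.span_singleton[OF module_vec])
      then have "axis 2 1 - t *s axis 1 1 = (0 :: S^3)"
        by (intro zero) (simp add: lincomb_diff lincomb_scale)
      then have "(axis 2 1 - t *s axis 1 1 :: S^3) $ 2 = 0"
        by simp
      then show False
        by (simp add: axis_def)
    qed
  qed
  moreover have "\<exists>s t. \<sigma> = s *s \<rho> $ 1 + t *s \<rho> $ 2" if \<sigma>: "\<sigma> \<in> AR f" "lin_dep3 (\<rho> $ 1) (\<rho> $ 2) \<sigma>" for \<sigma>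
  proof -
    obtain c where c: "\<sigma> = lincomb \<rho> c"
      using \<sigma>(1) gen by blast
    obtain x y z where xyz: "x \<noteq> 0 \<or> y \<noteq> 0 \<or> z \<noteq> 0" and
      dep: "x *s \<rho> $ 1 + y *s \<rho> $ 2 + z *s \<sigma> = 0"
      using \<sigma>(2) unfolding lin_dep3_def by blast
    have "lincomb \<rho> (x *s axis 1 1 + y *s axis 2 1 + z *s c) = 0"
      using dep by (simp add: lincomb_add lincomb_scale c)
    then have "x *s axis 1 1 + y *s axis 2 1 + z *s c = 0"
      by (rule zero)
    then have "x + z * c $ 1 = 0" "y + z * c $ 2 = 0" "z * c $ 3 = 0"
      by (simp_all only: vec_eq_iff forall_3) (simp_all add: axis_def)
    \<comment> \<open>If \<open>z\<close> were 0, then \<open>x\<close> and \<open>y\<close> would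
      vanish too; so \<open>z\<close> cancels.\<close>
    with xyz have "c $ 3 = 0"
      by (cases "z = 0") auto
    then have "\<sigma> = c $ 1 *s \<rho> $ 1 + c $ 2 *s \<rho> $ 2"
      by (simp add: c lincomb_def sum_3)
    then show ?thesis
      by blast
  qed
  moreover have "\<rho> $ i \<in> AR f" for i
    using \<rho> by (simp add: AR_deg_def)
  ultimately have "tame_wrt f (\<rho> $ 1) (\<rho> $ 2)"
    unfolding tame_wrt_def by (simp add: tame_sequence_exact_iff)
  then show ?thesis
    by (auto simp: tame_def)
qed

text \<open>Generators and relation are the images of the unit vectors under the two maps of the
  resolution. The common shift by \<open>d - 1\<close> is removed; \<open>1 \<le> d\<close> keeps
  the truncated subtraction exact.\<close>

lemma nearly_free_presentation:
  assumes "nearly_free f d d1 d2 d3" "1 \<le> d"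
  obtains \<rho> a where "presentation f (vector [d1, d2, d3, d3]) (d3 + 1) \<rho> a"
proof -
  let ?e = "vector [d1, d2, d3, d3] :: nat^4"
  let ?E = "vector [d + d1 - 1, d + d2 - 1, d + d3 - 1, d + d3 - 1] :: nat^4"
  obtain \<delta>3 :: "S^1 \<Rightarrow> S^4" and \<delta>2 :: "S^4 \<Rightarrow> S^4" where
    hom3: "module_hom (*s) (*s) \<delta>3" and deg3: "\<And>q. \<delta>3 ` twisted_deg (vector [d + d3]) q \<subseteq> twisted_deg ?E q" and
    hom2: "module_hom (*s) (*s) \<delta>2" and deg2: "\<And>q. \<delta>2 ` twisted_deg ?E q \<subseteq> twisted_deg (\<chi> i. d - 1) q" and
    ker: "range \<delta>3 = {v. \<delta>2 v = 0}" and im: "range \<delta>2 = {v. gradient_map f v = 0}"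
    using assms unfolding nearly_free_def graded_hom_def by blast
  have E: "?E $ i = d + ?e $ i - 1" for i
    using exhaust_4[of i] by (auto simp: vector_4)
  define \<rho> where "\<rho> = (\<chi> i. \<delta>2 (axis i 1))"
  define a where "a = \<delta>3 (axis 1 1)"
  have \<delta>2: "\<delta>2 = lincomb \<rho>"
    unfolding \<rho>_def by (rule ext) (rule module_hom_eq_lincomb[OF hom2])
  have \<delta>3: "\<delta>3 v = v $ 1 *s a" for v
    unfolding module_hom_eq_lincomb[OF hom3, of v] by (simp add: lincomb_def sum_1 a_def)
  have "range \<delta>3 = range (\<lambda>t. t *s a)"
  proof (intro equalityI subsetI)
    fix u assume "u \<in> range (\<lambda>t. t *s a)"
    then obtain t where "u = t *s a"
      by blast
    then have "u = \<delta>3 (\<chi> i. t)"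
      by (simp add: \<delta>3)
    then show "u \<in> range \<delta>3"
      by blast
  qed (auto simp: \<delta>3)
  then have "{b. lincomb \<rho> b = 0} = range (\<lambda>t. t *s a)"
    using ker \<delta>2 by simp
  moreover have gen: "range (lincomb \<rho>) = AR f"
    using im \<delta>2 by (simp add: AR_def)
  moreover have "\<rho> $ i \<in> AR_deg f (?e $ i)" for i
  proof -
    have "\<rho> $ i \<in> twisted_deg (\<chi> i. d - 1) (?E $ i)"
      using deg2[of "?E $ i"] axis_in_twisted_deg[of i ?E] by (auto simp: \<rho>_def)
    then have "mdeg m = ?e $ i" if "m \<in> Poly_Mapping.keys (\<rho> $ i $ j)" for m j
      using that assms(2) unfolding E twisted_deg_def by fastforce
    then have "\<forall>j. homogeneous (?e $ i) (\<rho> $ i $ j)"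
      by (simp add: homogeneous_def)
    moreover have "lincomb \<rho> (axis i 1) \<in> AR f"
      using gen by blast
    ultimately show ?thesis
      by (simp add: AR_deg_def)
  qed
  moreover have "a \<in> twisted_deg ?e (d3 + 1)"
  proof -
    have "a \<in> twisted_deg ?E (d + d3)"
      using deg3[of "d + d3"] axis_in_twisted_deg[of 1 "vector [d + d3] :: nat^1"] by (auto simp: a_def)
    then have "mdeg m + (d + ?e $ i - 1) = d + d3" if "m \<in> Poly_Mapping.keys (a $ i)" for m i
      using that unfolding twisted_deg_def E by blast
    then have "mdeg m + ?e $ i = d3 + 1" if "m \<in> Poly_Mapping.keys (a $ i)" for m i
      using that assms(2) by fastforce
    then show ?thesis
      by (simp add: twisted_deg_def)
  qed
  ultimately show thesis
    by (intro that[of \<rho> a]) (simp add: presentation_def)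
qed

text \<open>For \<open>d2 = d3\<close> the independence of the linear forms depends on the chosen
  system. Hence three versions: tameness with respect to the first two generators of any system,
  tameness itself when \<open>d2 < d3\<close>, and in general the existence of a suitable
  system.\<close>

theorem proposition2p5:
  fixes f :: S and d :: nat
  assumes "1 \<le> d" and "homogeneous d f"
    and "squarefree f"
    and "\<not> cone_over_plane_curve f"
    and "has_proj_dim (jacobian_ideal f) 1"
  shows "(free_surface f \<longrightarrow> tame f) \<and>
    (\<forall>d1 d2 d3. nearly_free f d d1 d2 d3 \<longrightarrow>
       (\<forall>\<rho> a. second_syzygy f d1 d2 d3 \<rho> a \<longrightarrow>
          (tame_wrt f (\<rho> $ 1) (\<rho> $ 2) \<longleftrightarrow> lin_indep2 (a $ 3) (a $ 4)) \<and>
          (d2 < d3 \<longrightarrow> (tame f \<longleftrightarrow> lin_indep2 (a $ 3) (a $ 4)))) \<and>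
       (tame f \<longleftrightarrow> (\<exists>\<rho> a. second_syzygy f d1 d2 d3 \<rho> a \<and> lin_indep2 (a $ 3) (a $ 4))))"
proof (rule conjI)
  show "free_surface f \<longrightarrow> tame f"
    by (simp add: free_surface_imp_tame)
  \<comment> \<open>0 is not squarefree, since its square divides it and it is not a unit.\<close>
  have "f \<noteq> 0"
  proof
    assume "f = 0"
    with \<open>squarefree f\<close> have "(0::S) ^ 2 dvd 0 \<longrightarrow> (0::S) dvd 1"
      unfolding squarefree_def by blast
    then show False
      by simp
  qed
  then obtain k where k: "partial k f \<noteq> 0"
    using exists_partial_nonzero[OF assms(2)] assms(1) by auto
  show "\<forall>d1 d2 d3. nearly_free f d d1 d2 d3 \<longrightarrow>
       (\<forall>\<rho> a. second_syzygy f d1 d2 d3 \<rho> a \<longrightarrow>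
          (tame_wrt f (\<rho> $ 1) (\<rho> $ 2) \<longleftrightarrow> lin_indep2 (a $ 3) (a $ 4)) \<and>
          (d2 < d3 \<longrightarrow> (tame f \<longleftrightarrow> lin_indep2 (a $ 3) (a $ 4)))) \<and>
       (tame f \<longleftrightarrow> (\<exists>\<rho> a. second_syzygy f d1 d2 d3 \<rho> a \<and> lin_indep2 (a $ 3) (a $ 4)))"
  proof (intro allI impI)
    fix d1 d2 d3 assume nf: "nearly_free f d d1 d2 d3"
    then have le: "d1 \<le> d2" "d2 \<le> d3"
      by (simp_all add: nearly_free_def)
    let ?e = "vector [d1, d2, d3, d3] :: nat^4"
    have e: "?e $ 1 \<le> ?e $ 2" "?e $ 2 \<le> ?e $ 3" "?e $ 4 = ?e $ 3" "d3 + 1 = ?e $ 3 + 1"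
      using le by (simp_all add: vector_4)
    have syz: "second_syzygy f d1 d2 d3 \<rho> a \<longleftrightarrow> presentation f ?e (d3 + 1) \<rho> a" for \<rho> a
      by (rule second_syzygy_iff_presentation[OF le])
    have iff: "tame_wrt f (\<rho> $ 1) (\<rho> $ 2) \<longleftrightarrow> lin_indep2 (a $ 3) (a $ 4)"
      if "second_syzygy f d1 d2 d3 \<rho> a" for \<rho> a
      using tame_wrt_iff_lin_indep2[OF _ e k] that unfolding syz by blast
    \<comment> \<open>A pair witnessing tameness is completed to a system of generators, to which
      the criterion \<open>iff\<close> applies.\<close>
    have adapted: "\<exists>\<rho>' a'. second_syzygy f d1 d2 d3 \<rho>' a' \<and> lin_indep2 (a' $ 3) (a' $ 4) \<and>
        (d2 < d3 \<longrightarrow> a' $ 3 = a $ 3 \<and> a' $ 4 = a $ 4)"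
      if tame: "tame f" and pr: "second_syzygy f d1 d2 d3 \<rho> a" for \<rho> a
    proof -
      obtain \<sigma>1 \<sigma>2 where \<sigma>: "tame_wrt f \<sigma>1 \<sigma>2"
        using tame unfolding tame_def by blast
      then have "minimal_pair f \<sigma>1 \<sigma>2"
        by (simp add: tame_wrt_def)
      then obtain \<rho>' a' where "presentation f ?e (d3 + 1) \<rho>' a'" "\<rho>' $ 1 = \<sigma>1" "\<rho>' $ 2 = \<sigma>2"
        "?e $ 2 < ?e $ 3 \<Longrightarrow> a' $ 3 = a $ 3 \<and> a' $ 4 = a $ 4"
        using presentation_extend_minimal_pair[OF pr[unfolded syz] e] by metis
      with \<sigma> iff[of \<rho>' a'] show ?thesis
        unfolding syz by (metis vector_4(2,3))
    qed
    have "tame f" if "second_syzygy f d1 d2 d3 \<rho> a" "lin_indep2 (a $ 3) (a $ 4)" for \<rho> a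
      using iff that unfolding tame_def by blast
    \<comment> \<open>The resolution supplies one system, from which \<open>adapted\<close> can
      start.\<close>
    moreover obtain \<rho>0 a0 where "second_syzygy f d1 d2 d3 \<rho>0 a0"
      unfolding syz using nearly_free_presentation[OF nf \<open>1 \<le> d\<close>] by blast
    ultimately show "(\<forall>\<rho> a. second_syzygy f d1 d2 d3 \<rho> a \<longrightarrow>
          (tame_wrt f (\<rho> $ 1) (\<rho> $ 2) \<longleftrightarrow> lin_indep2 (a $ 3) (a $ 4)) \<and>
          (d2 < d3 \<longrightarrow> (tame f \<longleftrightarrow> lin_indep2 (a $ 3) (a $ 4)))) \<and>
       (tame f \<longleftrightarrow> (\<exists>\<rho> a. second_syzygy f d1 d2 d3 \<rho> a \<and> lin_indep2 (a $ 3) (a $ 4)))"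
      using iff adapted by metis
  qed
qed

end
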